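(* Let $\Delta t>0$, $u_h^0=\Pi u_0\in V_h$ and $U^0=\sqrt{F(u_0)+B}\in C^0(\Omega)$. For $n\ge 0$ consider the following scheme: given $u_h^n\in V_h$ and $U^n\in C^0(\Omega)$, find $(u_h^{n+1},w_h^{n+1})\in V_h\times V_h$ and $U^{n+1}\in C^0(\Omega)$ such that for all $\phi,\psi\in V_h$ $$\left(\frac{u_h^{n+1}-u_h^n}{\Delta t},\phi\right)=-A(M(u_h^n);w_h^{n+1},\phi),$$ $$(w_h^{n+1},\psi)=A(\epsilon^2;u_h^{n+1},\psi)+\left(H(u_h^n)U^{n+1},\psi\right),$$ $$\frac{U^{n+1}-U^n}{\Delta t}=\frac12 H(u_h^n)\frac{u_h^{n+1}-u_h^n}{\Delta t}\quad\text{(pointwise)}.$$ Then for any $\Delta t>0$ the scheme has a unique solution $(u_h^{n+1},w_h^{n+1},U^{n+1})\in V_h\times V_h\times C^0(\Omega)$. The solution satisfies total mass conservation $\int_\Omega u_h^n\,dx=\int_\Omega u_h^0\,dx$ for any $n>0$. Additionally, it satisfies, independently of the size of the time step $\Delta t$, the energy dissipation law $$E(u_h^{n+1},U^{n+1})=E(u_h^n,U^n)-\|U^{n+1}-U^n\|^2-\Delta t\,A(M(u_h^n);w_h^{n+1},w_h^{n+1})-\frac12A(\epsilon^2;u_h^{n+1}-u_h^n,u_h^{n+1}-u_h^n).$$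
   Context: $\Omega\subset\mathbb{R}^d$ ($d=2,3$) is a bounded domain and $\epsilon>0$ is a constant. $\mathcal T$ is a quasi-uniform triangulation $\Omega=\cup_{i=1}^N T_i$, and $V_h=\{v\in C^0(\Omega)\cap H^1(\Omega): v|_{T_i}\in P_k\ \forall T_i\in\mathcal T\}$, where $P_k$ is the space of polynomials of degree at most $k$ ($k\ge1$ fixed). $C^0(\Omega)$ denotes functions continuous on $\overline\Omega$. $(\cdot,\cdot)$ and $\|\cdot\|$ are the $L^2(\Omega)$ inner product and norm. $\Pi$ is the $L^2(\Omega)$-orthogonal projection onto $V_h$. For a coefficient $a(x)$, $A(a;q,v)=\int_\Omega a(x)\nabla q\cdot\nabla v\,dx$. The potential $F$ is a $C^1$ function on an interval $I\subseteq\mathbb{R}$ (e.g. $F(u)=\frac14(u^2-1)^2$ with $I=\mathbb{R}$, or the logarithmic Flory–Huggins potential with $I=(0,1)$). The constant $B\ge0$ is such that $F+B>0$, and $H(w)=F'(w)/\sqrt{F(w)+B}$. The mobility $M\ge0$ is a continuous function. It is a standing assumption that all functions at which $F,F',H,M$ are evaluated take values (on $\overline\Omega$) where these are defined and $F+B>0$. $u_0$ is the given initial datum. The energy is $E(v,V)=\frac12A(\epsilon^2;v,v)+\int_\Omega V^2\,dx-B|\Omega|$. *)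

theory Defs
  imports "HOL-Analysis.Analysis"
begin

section \<open>Function spaces\<close>

definition inner_L2 :: "(real^'d) set \<Rightarrow> (real^'d \<Rightarrow> real) \<Rightarrow> (real^'d \<Rightarrow> real) \<Rightarrow> real" where
  "inner_L2 \<Omega> f g = integral\<^sup>L (lebesgue_on \<Omega>) (\<lambda>x. f x * g x)"

definition norm_L2 :: "(real^'d) set \<Rightarrow> (real^'d \<Rightarrow> real) \<Rightarrow> real" where
  "norm_L2 \<Omega> f = sqrt (inner_L2 \<Omega> f f)"

definition L2_space :: "(real^'d) set \<Rightarrow> (real^'d \<Rightarrow> 'b::euclidean_space) set" where
  "L2_space \<Omega> = {f. f \<in> borel_measurable (lebesgue_on \<Omega>) \<and>
                    integrable (lebesgue_on \<Omega>) (\<lambda>x. (norm (f x))\<^sup>2)}"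

text \<open>
  Functions continuous on the closure of \<open>\<Omega>\<close>. A function on the closure is represented by its
  extension by zero to the whole space, so that equality in \<open>C0 \<Omega>\<close> is equality of functions on
  the closure. No continuity across the boundary is implied.
\<close>
definition C0 :: "(real^'d) set \<Rightarrow> (real^'d \<Rightarrow> real) set" where
  "C0 \<Omega> = {f. continuous_on (closure \<Omega>) f \<and> (\<forall>x. x \<notin> closure \<Omega> \<longrightarrow> f x = 0)}"

definition partial_deriv :: "'d::finite \<Rightarrow> (real^'d \<Rightarrow> real) \<Rightarrow> real^'d \<Rightarrow> real" where
  "partial_deriv i \<phi> x = frechet_derivative \<phi> (at x) (axis i 1)"

primrec Ck_fun :: "nat \<Rightarrow> (real^'d \<Rightarrow> real) \<Rightarrow> bool" where
  "Ck_fun 0 \<phi> \<longleftrightarrow> continuous_on UNIV \<phi>"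
| "Ck_fun (Suc m) \<phi> \<longleftrightarrow> \<phi> differentiable_on UNIV \<and> (\<forall>i. Ck_fun m (partial_deriv i \<phi>))"

text \<open>The space of smooth functions with compact support in \<open>\<Omega>\<close>.\<close>
definition test_functions :: "(real^'d) set \<Rightarrow> (real^'d \<Rightarrow> real) set" where
  "test_functions \<Omega> = {\<phi>. (\<forall>m. Ck_fun m \<phi>) \<and>
     compact (closure {x. \<phi> x \<noteq> 0}) \<and> closure {x. \<phi> x \<noteq> 0} \<subseteq> \<Omega>}"

definition is_weak_gradient ::
    "(real^'d) set \<Rightarrow> (real^'d \<Rightarrow> real) \<Rightarrow> (real^'d \<Rightarrow> real^'d) \<Rightarrow> bool" where
  "is_weak_gradient \<Omega> v G \<longleftrightarrow> (\<forall>\<phi>\<in>test_functions \<Omega>. \<forall>i.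
     integral\<^sup>L (lebesgue_on \<Omega>) (\<lambda>x. v x * partial_deriv i \<phi> x)
       = - integral\<^sup>L (lebesgue_on \<Omega>) (\<lambda>x. G x $ i * \<phi> x))"

definition H1_space :: "(real^'d) set \<Rightarrow> (real^'d \<Rightarrow> real) set" where
  "H1_space \<Omega> = {v \<in> L2_space \<Omega>. \<exists>G\<in>L2_space \<Omega>. is_weak_gradient \<Omega> v G}"

text \<open>
  The weak gradient of an \<open>H\<^sup>1\<close> function is determined up to null sets; this picks a
  representative. It is only used under integrals over \<open>\<Omega>\<close>.
\<close>
definition weak_grad :: "(real^'d) set \<Rightarrow> (real^'d \<Rightarrow> real) \<Rightarrow> real^'d \<Rightarrow> real^'d" where
  "weak_grad \<Omega> v = (SOME G. G \<in> L2_space \<Omega> \<and> is_weak_gradient \<Omega> v G)"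

section \<open>The finite element space\<close>

definition Pk :: "nat \<Rightarrow> (real^'d \<Rightarrow> real) set" where
  "Pk k = {p. \<exists>c :: ('d \<Rightarrow> nat) \<Rightarrow> real.
     \<forall>x. p x = (\<Sum>\<alpha> | (\<Sum>i\<in>UNIV. \<alpha> i) \<le> k. c \<alpha> * (\<Prod>i\<in>UNIV. (x $ i) ^ \<alpha> i))}"

text \<open>
  The cells are closed full-dimensional simplices meeting in common faces. They cover the closure
  of the open set \<open>\<Omega>\<close>, and their interiors lie in \<open>\<Omega>\<close>, so \<open>\<Omega>\<close> is the union of the cells up to
  a null set.
\<close>
definition triangulates :: "(real^'d) set set \<Rightarrow> (real^'d) set \<Rightarrow> bool" where
  "triangulates \<T> \<Omega> \<longleftrightarrow> triangulation \<T> \<and> (\<forall>T\<in>\<T>. int CARD('d) simplex T) \<and>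
     \<Union>\<T> = closure \<Omega> \<and> (\<forall>T\<in>\<T>. interior T \<subseteq> \<Omega>)"

text \<open>
  Every cell contains a ball whose diameter is at least \<open>\<rho>\<close> times the mesh size, the maximal
  diameter of a cell.
\<close>
definition quasi_uniform :: "real \<Rightarrow> (real^'d) set set \<Rightarrow> bool" where
  "quasi_uniform \<rho> \<T> \<longleftrightarrow> \<rho> > 0 \<and> (\<forall>T\<in>\<T>. \<exists>x. ball x (\<rho> * Max (diameter ` \<T>) / 2) \<subseteq> T)"

definition FE_space :: "(real^'d) set \<Rightarrow> (real^'d) set set \<Rightarrow> nat \<Rightarrow> (real^'d \<Rightarrow> real) set" where
  "FE_space \<Omega> \<T> k = {v \<in> C0 \<Omega> \<inter> H1_space \<Omega>. \<forall>T\<in>\<T>. \<exists>p\<in>Pk k. \<forall>x\<in>T. v x = p x}"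

definition L2_proj ::
    "(real^'d) set \<Rightarrow> (real^'d \<Rightarrow> real) set \<Rightarrow> (real^'d \<Rightarrow> real) \<Rightarrow> real^'d \<Rightarrow> real" where
  "L2_proj \<Omega> V f = (THE v. v \<in> V \<and> (\<forall>\<phi>\<in>V. inner_L2 \<Omega> (\<lambda>x. f x - v x) \<phi> = 0))"

section \<open>The scheme\<close>

definition A_form ::
    "(real^'d) set \<Rightarrow> (real^'d \<Rightarrow> real) \<Rightarrow> (real^'d \<Rightarrow> real) \<Rightarrow> (real^'d \<Rightarrow> real) \<Rightarrow> real" where
  "A_form \<Omega> a q v =
     integral\<^sup>L (lebesgue_on \<Omega>) (\<lambda>x. a x * (weak_grad \<Omega> q x \<bullet> weak_grad \<Omega> v x))"

text \<open>The argument \<open>F'\<close> is the derivative of the potential \<open>F\<close>.\<close>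
definition H_fun :: "(real \<Rightarrow> real) \<Rightarrow> (real \<Rightarrow> real) \<Rightarrow> real \<Rightarrow> real \<Rightarrow> real" where
  "H_fun F F' B s = F' s / sqrt (F s + B)"

definition energy ::
    "(real^'d) set \<Rightarrow> real \<Rightarrow> real \<Rightarrow> (real^'d \<Rightarrow> real) \<Rightarrow> (real^'d \<Rightarrow> real) \<Rightarrow> real" where
  "energy \<Omega> \<epsilon> B v V = 1/2 * A_form \<Omega> (\<lambda>_. \<epsilon>\<^sup>2) v v
     + integral\<^sup>L (lebesgue_on \<Omega>) (\<lambda>x. (V x)\<^sup>2) - B * measure lebesgue \<Omega>"

text \<open>
  One time step: \<open>(u', w', U')\<close> is a solution for the data \<open>(u, U)\<close>; \<open>H\<close> and \<open>M\<close> are functions of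
  the phase variable.
\<close>
definition scheme_step ::
    "(real^'d) set \<Rightarrow> (real^'d \<Rightarrow> real) set \<Rightarrow> real \<Rightarrow> real \<Rightarrow> (real \<Rightarrow> real) \<Rightarrow> (real \<Rightarrow> real)
     \<Rightarrow> (real^'d \<Rightarrow> real) \<Rightarrow> (real^'d \<Rightarrow> real)
     \<Rightarrow> (real^'d \<Rightarrow> real) \<Rightarrow> (real^'d \<Rightarrow> real) \<Rightarrow> (real^'d \<Rightarrow> real) \<Rightarrow> bool" where
  "scheme_step \<Omega> Vh \<epsilon> \<Delta>t H M u U u' w' U' \<longleftrightarrow>
     u' \<in> Vh \<and> w' \<in> Vh \<and> U' \<in> C0 \<Omega> \<and>
     (\<forall>\<phi>\<in>Vh. inner_L2 \<Omega> (\<lambda>x. (u' x - u x) / \<Delta>t) \<phi> = - A_form \<Omega> (\<lambda>x. M (u x)) w' \<phi>) \<and>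
     (\<forall>\<psi>\<in>Vh. inner_L2 \<Omega> w' \<psi>
        = A_form \<Omega> (\<lambda>_. \<epsilon>\<^sup>2) u' \<psi> + inner_L2 \<Omega> (\<lambda>x. H (u x) * U' x) \<psi>) \<and>
     (\<forall>x\<in>closure \<Omega>. (U' x - U x) / \<Delta>t = 1/2 * H (u x) * ((u' x - u x) / \<Delta>t))"

end

theory Submission
  imports Defs
begin

text \<open>
  Write \<open>ip\<close> for the \<open>L\<^sup>2\<close> inner product, \<open>S\<close> for \<open>A(\<epsilon>\<^sup>2; _, _)\<close>, \<open>K\<close> for \<open>A(M(u); _, _)\<close>, and
  \<open>h = H(u)\<close>, where \<open>u\<close> is the current iterate. The pointwise equation expresses \<open>U'\<close> through
  \<open>u'\<close>: \<open>U' = U + h (u' - u) / 2\<close>. Substituting this into the second equation leaves a linear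
  system for \<open>(u', w')\<close> on the finite element space \<open>V\<close>,

    \<open>ip u' \<phi> + \<tau> K w' \<phi> = ip u \<phi>\<close>  and  \<open>ip w' \<psi> = a u' \<psi> + g \<psi>\<close>,

  where \<open>a v \<psi> = S v \<psi> + ip (h\<^sup>2 v / 2) \<psi>\<close>. Both \<open>K\<close> and \<open>a\<close> are symmetric and positive semidefinite.
  A solution of the homogeneous system, tested with \<open>\<phi> = w'\<close> and \<open>\<psi> = u'\<close>, satisfies
  \<open>a u' u' + \<tau> K w' w' = 0\<close>. Hence \<open>a u' u' = 0\<close>, so \<open>a u' \<psi> = 0\<close> for every \<open>\<psi>\<close> by semidefiniteness;
  the second equation then gives \<open>w' = 0\<close> and the first one \<open>u' = 0\<close>. Since \<open>V\<close> is finitely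
  generated, the system is also solvable (\<open>mixed_system_unique\<close>, \<open>mixed_system_solvable\<close>).

  Mass conservation is the first equation tested with the constant function one, whose weak gradient
  vanishes (\<open>scheme_step_mass_conservation\<close>). The energy law is the first equation tested with
  \<open>w'\<close> and the second one with \<open>u' - u\<close>, where \<open>h U' (u' - u) = 2 U' (U' - U)\<close> by the pointwise
  equation, combined with the identity \<open>b x x - b y y = 2 b x (x - y) - b (x - y) (x - y)\<close> for
  symmetric forms \<open>b\<close> (\<open>scheme_step_energy\<close>).

  All of this relies on \<open>A\<close> being a bilinear form on \<open>H\<^sup>1\<close>, that is, on the weak gradient being
  linear up to null sets. As the weak gradient is merely some function with the defining property, this
  rests on its uniqueness, which is the fundamental lemma of the calculus of variations; that lemma
  is obtained from explicit smooth functions that converge to the indicator function of a box.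
\<close>

section \<open>Smooth bump functions\<close>

lemma partial_deriv_eq:
  assumes "(f has_derivative D) (at x)"
  shows "partial_deriv i f x = D (axis i 1)"
  using assms unfolding partial_deriv_def by (metis frechet_derivative_at)

lemma Ck_fun_continuous: "Ck_fun m f \<Longrightarrow> continuous_on UNIV f"
  by (cases m) (auto intro: differentiable_imp_continuous_on)

lemma Ck_fun_SucD: "Ck_fun (Suc m) f \<Longrightarrow> Ck_fun m f"
proof (induction m arbitrary: f)
  case 0
  then show ?case by (auto intro: differentiable_imp_continuous_on)
next
  case (Suc m)
  from Suc.prems have "f differentiable_on UNIV" "\<And>i. Ck_fun (Suc m) (partial_deriv i f)"
    by simp_all
  then show ?case using Suc.IH by simp
qed

lemma Ck_fun_const: "Ck_fun m (\<lambda>x. c)"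
proof (induction m arbitrary: c)
  case (Suc m)
  have "partial_deriv i (\<lambda>x. c) = (\<lambda>x. 0)" for i :: 'a
    by (rule ext, subst partial_deriv_eq[OF has_derivative_const]) simp
  then show ?case using Suc by simp
qed simp

lemma Ck_fun_add:
  assumes "Ck_fun m f" "Ck_fun m g"
  shows "Ck_fun m (\<lambda>x. f x + g x)"
  using assms
proof (induction m arbitrary: f g)
  case (Suc m)
  then have d: "f differentiable at x" "g differentiable at x" for x
    by (auto simp: differentiable_on_def)
  have "partial_deriv i (\<lambda>x. f x + g x) = (\<lambda>x. partial_deriv i f x + partial_deriv i g x)" for i
    by (rule ext, subst partial_deriv_eq[OF has_derivative_add[OF d[THEN frechet_derivative_works[THEN iffD1]]]])
       (simp add: partial_deriv_def)
  moreover have "(\<lambda>x. f x + g x) differentiable_on UNIV"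
    using Suc.prems by (auto intro: differentiable_on_add)
  ultimately show ?case using Suc by simp
qed (auto intro: continuous_intros)

lemma Ck_fun_mult:
  assumes "Ck_fun m f" "Ck_fun m g"
  shows "Ck_fun m (\<lambda>x. f x * g x)"
  using assms
proof (induction m arbitrary: f g)
  case (Suc m)
  then have d: "f differentiable at x" "g differentiable at x" for x
    by (auto simp: differentiable_on_def)
  have "partial_deriv i (\<lambda>x. f x * g x)
      = (\<lambda>x. f x * partial_deriv i g x + partial_deriv i f x * g x)" for i
    by (rule ext, subst partial_deriv_eq[OF has_derivative_mult[OF d[THEN frechet_derivative_works[THEN iffD1]]]])
       (simp add: partial_deriv_def)
  moreover have "(\<lambda>x. f x * g x) differentiable_on UNIV"
    using Suc.prems by (auto intro: differentiable_on_mult)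
  moreover have "Ck_fun m f" "Ck_fun m g"
    using Suc.prems Ck_fun_SucD by blast+
  ultimately show ?case using Suc by (simp add: Ck_fun_add)
qed (auto intro: continuous_intros)

lemma Ck_fun_prod:
  assumes "\<And>i. i \<in> A \<Longrightarrow> Ck_fun m (f i)"
  shows "Ck_fun m (\<lambda>x. \<Prod>i\<in>A. f i x)"
  using assms by (induction A rule: infinite_finite_induct) (auto simp: Ck_fun_const Ck_fun_mult)

text \<open>
  The functions \<open>p(1/s) exp(-1/s)\<close>, extended by zero to \<open>s \<le> 0\<close>, with a polynomial \<open>p\<close>. The
  polynomial factor makes the family closed under differentiation, so that smoothness of all its
  members follows by one induction.
\<close>
definition flat_exp :: "real poly \<Rightarrow> real \<Rightarrow> real" where
  "flat_exp p s = (if s > 0 then poly p (1 / s) * exp (- (1 / s)) else 0)"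

lemma poly_times_exp_neg_tendsto_0: "((\<lambda>y. poly p y * exp (- y)) \<longlongrightarrow> (0::real)) at_top"
proof -
  have "((\<lambda>y. \<Sum>i\<le>degree p. coeff p i * (y ^ i / exp y)) \<longlongrightarrow> (\<Sum>i\<le>degree p. coeff p i * 0)) at_top"
    by (intro tendsto_intros tendsto_power_div_exp_0)
  then show ?thesis
    by (simp add: poly_altdef sum_distrib_right exp_minus divide_inverse mult.assoc)
qed

lemma flat_exp_tendsto_0: "(flat_exp p \<longlongrightarrow> 0) (at 0)"
proof -
  have "((\<lambda>s. poly p (1 / s) * exp (- (1 / s))) \<longlongrightarrow> 0) (at_right 0)"
    using filterlim_compose[OF poly_times_exp_neg_tendsto_0 filterlim_inverse_at_top_right]
    by (simp add: inverse_eq_divide)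
  then have "(flat_exp p \<longlongrightarrow> 0) (at_right 0)"
    by (rule Lim_transform_eventually)
       (auto simp: flat_exp_def eventually_at_right_less intro: eventually_mono[OF eventually_at_right_less])
  moreover have "(flat_exp p \<longlongrightarrow> 0) (at_left 0)"
    by (rule Lim_transform_eventually[OF tendsto_const])
       (auto simp: flat_exp_def eventually_at_left_field intro!: exI[of _ "-1"])
  ultimately show ?thesis
    by (rule filterlim_split_at[rotated])
qed

text \<open>
  For \<open>s > 0\<close> and \<open>y = 1/s\<close> the derivative is \<open>y\<^sup>2 (p(y) - p'(y)) exp(-y)\<close>. At \<open>s = 0\<close> the difference
  quotient is the member of the family that belongs to the polynomial \<open>y p(y)\<close>, and it tends to 0.
\<close>
lemma flat_exp_has_derivative:
  "(flat_exp p has_real_derivative flat_exp (monom 1 2 * (p - pderiv p)) s) (at s)"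
proof -
  consider "s > 0" | "s < 0" | "s = 0" by linarith
  then show ?thesis
  proof cases
    case 1
    have "((\<lambda>s. poly p (1 / s) * exp (- (1 / s))) has_real_derivative
        flat_exp (monom 1 2 * (p - pderiv p)) s) (at s)"
      using 1 by (auto intro!: derivative_eq_intros DERIV_chain2[OF poly_DERIV]
          simp: flat_exp_def poly_monom field_simps power2_eq_square)
    then show ?thesis
      by (rule DERIV_cong_ev[THEN iffD1, rotated 3])
         (use 1 in \<open>auto simp: flat_exp_def intro!: eventually_mono[OF eventually_nhds_in_open[of "{0<..}"]]\<close>)
  next
    case 2
    have "((\<lambda>s. 0) has_real_derivative flat_exp (monom 1 2 * (p - pderiv p)) s) (at s)"
      using 2 by (auto simp: flat_exp_def)
    then show ?thesis
      by (rule DERIV_cong_ev[THEN iffD1, rotated 3])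
         (use 2 in \<open>auto simp: flat_exp_def intro!: eventually_mono[OF eventually_nhds_in_open[of "{..<0}"]]\<close>)
  next
    case 3
    have "((\<lambda>h. (flat_exp p h - flat_exp p 0) / h) \<longlongrightarrow> 0) (at 0)"
      using flat_exp_tendsto_0[of "pCons 0 p"]
      by (rule Lim_transform_eventually) (auto simp: flat_exp_def)
    then show ?thesis
      using 3 by (simp add: DERIV_def flat_exp_def)
  qed
qed

lemma Ck_fun_flat_exp: "Ck_fun m (\<lambda>x::real^'d. flat_exp p (c * x $ i + e))"
proof (induction m arbitrary: p)
  case 0
  have "isCont (flat_exp p) s" for s
    using flat_exp_has_derivative DERIV_isCont by blast
  then have "continuous_on UNIV (flat_exp p)"
    by (simp add: continuous_at_imp_continuous_on)
  then have "continuous_on UNIV (\<lambda>x::real^'d. flat_exp p (c * x $ i + e))"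
    by (rule continuous_on_compose2) (auto intro!: continuous_intros)
  then show ?case by simp
next
  case (Suc m)
  \<comment> \<open>A partial derivative is zero or a multiple of the same function with \<open>?q\<close> in place of \<open>p\<close>.\<close>
  let ?q = "monom 1 2 * (p - pderiv p)"
  have D: "((\<lambda>x::real^'d. flat_exp p (c * x $ i + e)) has_derivative
      (\<lambda>h. flat_exp ?q (c * x $ i + e) * (c * h $ i))) (at x)" for x
    by (rule has_derivative_compose[where f = "\<lambda>x. c * x $ i + e" and g = "flat_exp p"])
       (auto intro!: derivative_eq_intros flat_exp_has_derivative[unfolded has_field_derivative_def]
          bounded_linear.has_derivative[OF bounded_linear_vec_nth])
  have "partial_deriv j (\<lambda>x::real^'d. flat_exp p (c * x $ i + e))
      = (\<lambda>x. flat_exp ?q (c * x $ i + e) * (if j = i then c else 0))" for j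
    by (rule ext, subst partial_deriv_eq[OF D]) (auto simp: axis_def)
  moreover have "(\<lambda>x::real^'d. flat_exp p (c * x $ i + e)) differentiable_on UNIV"
    using D by (auto simp: differentiable_on_def differentiable_def)
  ultimately show ?case
    unfolding Ck_fun.simps by (auto intro!: Ck_fun_mult Ck_fun_const Suc.IH simp del: mult_if_delta)
qed

text \<open>
  The two factors of each coordinate vanish to the left of \<open>a\<close> and to the right of \<open>b\<close>. As
  \<open>exp(-1/(n s)) = exp(-1/s) powr (1/n)\<close>, increasing \<open>n\<close> amounts to taking roots, which pushes the
  values inside the box up to 1.
\<close>
definition box_bump :: "real^'d \<Rightarrow> real^'d \<Rightarrow> nat \<Rightarrow> real^'d \<Rightarrow> real" where
  "box_bump a b n x = (\<Prod>i\<in>UNIV. flat_exp 1 (real (Suc n) * (x $ i - a $ i))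
     * flat_exp 1 (real (Suc n) * (b $ i - x $ i)))"

lemma box_bump_smooth: "Ck_fun m (box_bump a b n)"
proof -
  have "Ck_fun m (\<lambda>x. \<Prod>i\<in>UNIV. flat_exp 1 (real (Suc n) * x $ i + - real (Suc n) * a $ i)
      * flat_exp 1 (- real (Suc n) * x $ i + real (Suc n) * b $ i))"
    by (intro Ck_fun_prod Ck_fun_mult Ck_fun_flat_exp)
  moreover have "box_bump a b n = (\<lambda>x. \<Prod>i\<in>UNIV. flat_exp 1 (real (Suc n) * x $ i + - real (Suc n) * a $ i)
      * flat_exp 1 (- real (Suc n) * x $ i + real (Suc n) * b $ i))"
    by (rule ext) (simp add: box_bump_def algebra_simps)
  ultimately show ?thesis by simp
qed

lemma flat_exp_1_bounds: "0 \<le> flat_exp 1 s" "flat_exp 1 s \<le> 1"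
  by (auto simp: flat_exp_def)

lemma box_bump_bound: "\<bar>box_bump a b n x\<bar> \<le> 1"
  unfolding box_bump_def
  by (auto simp: abs_prod abs_mult flat_exp_1_bounds intro!: prod_le_1 mult_le_one)

lemma box_bump_outside: "x \<notin> box a b \<Longrightarrow> box_bump a b n x = 0"
  by (auto simp: mem_box_cart box_bump_def flat_exp_def zero_less_mult_iff)

lemma flat_exp_1_tendsto_1:
  assumes "s > 0"
  shows "(\<lambda>n. flat_exp 1 (real (Suc n) * s)) \<longlonglongrightarrow> 1"
proof -
  have "(\<lambda>n. exp (- (1 / s * inverse (real (Suc n))))) \<longlonglongrightarrow> exp (- (1 / s * 0))"
    by (intro tendsto_intros LIMSEQ_inverse_real_of_nat)
  then show ?thesis
    using assms by (simp add: flat_exp_def field_simps del: of_nat_Suc)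
qed

lemma box_bump_tendsto: "(\<lambda>n. box_bump a b n x) \<longlonglongrightarrow> indicator (box a b) x"
proof (cases "x \<in> box a b")
  case True
  then have "(\<lambda>n. box_bump a b n x) \<longlonglongrightarrow> (\<Prod>i\<in>(UNIV::'a set). 1 * 1)"
    unfolding box_bump_def
    by (intro tendsto_prod tendsto_mult flat_exp_1_tendsto_1) (auto simp: mem_box_cart)
  then show ?thesis using True by simp
qed (simp add: box_bump_outside)

lemma box_bump_test_function:
  assumes "cbox a b \<subseteq> \<Omega>"
  shows "box_bump a b n \<in> test_functions \<Omega>"
proof -
  have "{x. box_bump a b n x \<noteq> 0} \<subseteq> cbox a b"
    using box_bump_outside box_subset_cbox by blast
  then have "closure {x. box_bump a b n x \<noteq> 0} \<subseteq> cbox a b"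
    by (rule closure_minimal) (rule closed_cbox)
  moreover from this have "compact (closure {x. box_bump a b n x \<noteq> 0})"
    using compact_cbox[of a b] closed_closure by (metis compact_Int_closed inf.absorb_iff2)
  ultimately show ?thesis
    unfolding test_functions_def using assms box_bump_smooth[of _ a b n] by blast
qed

section \<open>The fundamental lemma of the calculus of variations\<close>

text \<open>
  The boxes generate the Borel sets and are stable under intersection, so by Dynkin's argument the
  integral of \<open>f\<close> vanishes over every Borel set. A Borel representative \<open>g\<close> of \<open>f\<close> is used, since
  the Lebesgue measurable sets themselves are not generated by boxes.
\<close>
lemma AE_zero_if_box_integrals_zero:
  fixes f :: "'a::euclidean_space \<Rightarrow> real"
  assumes f: "integrable lebesgue f" and boxes: "\<And>a b. (LINT x:box a b|lebesgue. f x) = 0"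
  shows "AE x in lebesgue. f x = 0"
proof -
  obtain g where g [measurable]: "g \<in> borel_measurable lborel" and fg: "AE x in lborel. f x = g x"
    using completion_ex_borel_measurable_real[OF borel_measurable_integrable[OF f]] by blast
  have fg': "AE x in lebesgue. f x = g x"
    using fg by (rule AE_completion)
  have [measurable]: "f \<in> borel_measurable lebesgue"
    using f by (rule borel_measurable_integrable)
  have [measurable]: "g \<in> borel_measurable lebesgue"
    using g by (rule measurable_completion)
  have "integrable lebesgue g"
    using integrable_cong_AE[THEN iffD1, OF _ _ fg' f] by simp
  then have int_g: "integrable lborel g"
    using g by (simp add: integrable_completion)
  have g_boxes: "(LINT x:box a b|lborel. g x) = 0" for a b
  proof -
    have "(LINT x:box a b|lborel. g x) = (LINT x:box a b|lebesgue. g x)"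
      unfolding set_lebesgue_integral_def by (rule integral_completion[symmetric]) measurable
    also have "\<dots> = (LINT x:box a b|lebesgue. f x)"
      unfolding set_lebesgue_integral_def
      by (rule integral_cong_AE) (use fg' in \<open>auto intro!: borel_measurable_times borel_measurable_indicator\<close>)
    finally show ?thesis using boxes by simp
  qed
  have si: "set_integrable lborel A g" if "A \<in> sets borel" for A
    unfolding set_integrable_def using int_g that by (intro integrable_mult_indicator) auto
  have g_UNIV: "(LINT x:UNIV|lborel. g x) = 0"
  proof -
    let ?B = "\<lambda>n::nat. box (- (real n *\<^sub>R One)) (real n *\<^sub>R One) :: 'a set"
    have "(\<lambda>n. LINT x:?B n|lborel. g x) \<longlonglongrightarrow> (LINT x:(\<Union>n. ?B n)|lborel. g x)"
    proof (rule set_integral_cont_up)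
      show "incseq ?B"
        by (auto simp: incseq_def mem_box intro: le_less_trans less_le_trans)
           (smt (verit) of_nat_mono)+
    qed (use si in auto)
    then show ?thesis
      by (simp add: g_boxes UN_box_eq_UNIV LIMSEQ_const_iff)
  qed
  have boxes_Int_stable: "Int_stable (range (\<lambda>(a, b). box a b :: 'a set))"
    by (auto simp: Int_stable_def box_Int_box)
  have boxes_Pow: "range (\<lambda>(a, b). box a b :: 'a set) \<subseteq> Pow UNIV" by simp
  have zero: "(LINT x:A|lborel. g x) = 0" if "A \<in> sigma_sets UNIV (range (\<lambda>(a, b). box a b))" for A
    using boxes_Int_stable boxes_Pow that
  proof (induction rule: sigma_sets_induct_disjoint)
    case (basic A)
    then show ?case using g_boxes by auto
  next
    case (compl A)
    then have A: "A \<in> sets borel" by (simp add: borel_eq_box)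
    have "(LINT x:UNIV|lborel. g x) = (LINT x:A|lborel. g x) + (LINT x:UNIV - A|lborel. g x)"
      using set_integral_Un[of A "UNIV - A" lborel g] si A by (simp add: Un_Diff_cancel)
    then show ?case using compl g_UNIV by simp
  next
    case (union A)
    then have A: "A i \<in> sets borel" for i by (auto simp: borel_eq_box)
    have "(LINT x:(\<Union>i. A i)|lborel. g x) = (\<Sum>i. LINT x:A i|lborel. g x)"
      by (rule lebesgue_integral_countable_add)
         (use union A si in \<open>auto simp: disjoint_family_on_def\<close>)
    then show ?case using union by simp
  qed (simp add: set_lebesgue_integral_def)
  have "AE x in lborel. g x = 0"
    by (rule density_unique_real[OF int_g])
       (use zero in \<open>auto simp: borel_eq_box set_lebesgue_integral_def\<close>)
  then have "AE x in lborel. f x = 0"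
    using fg by eventually_elim simp
  then show ?thesis by (rule AE_completion)
qed

text \<open>
  Testing with the bumps of a box and passing to the limit shows that \<open>G\<close> has integral zero over
  every box whose closure lies in \<open>\<Omega>\<close>. On one such box this forces \<open>G = 0\<close> almost everywhere,
  because its intersection with any other box is again of this kind. Countably many boxes
  cover \<open>\<Omega>\<close>.
\<close>
lemma fundamental_lemma_calculus_of_variations:
  fixes G :: "real^'d \<Rightarrow> real"
  assumes \<Omega>: "open \<Omega>" and G: "integrable (lebesgue_on \<Omega>) G"
    and zero: "\<And>\<phi>. \<phi> \<in> test_functions \<Omega> \<Longrightarrow> integral\<^sup>L (lebesgue_on \<Omega>) (\<lambda>x. G x * \<phi> x) = 0"
  shows "AE x in lebesgue_on \<Omega>. G x = 0"
proof -
  have \<Omega>_sets [measurable]: "\<Omega> \<in> sets lebesgue" using \<Omega> by auto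
  have box_zero: "(LINT x:box a b|lebesgue. G x) = 0" if ab: "cbox a b \<subseteq> \<Omega>" for a b
  proof -
    have "(\<lambda>n. integral\<^sup>L (lebesgue_on \<Omega>) (\<lambda>x. G x * box_bump a b n x))
        \<longlonglongrightarrow> integral\<^sup>L (lebesgue_on \<Omega>) (\<lambda>x. G x * indicator (box a b) x)"
    proof (rule integral_dominated_convergence)
      have [measurable]: "box_bump a b n \<in> borel_measurable (lebesgue_on \<Omega>)" for n
        using Ck_fun_continuous[OF box_bump_smooth[of 0 a b n]] \<Omega>
        by (intro continuous_imp_measurable_on_sets_lebesgue) (auto intro: continuous_on_subset)
      have [measurable]: "G \<in> borel_measurable (lebesgue_on \<Omega>)" using G by simp
      show "(\<lambda>x. G x * box_bump a b n x) \<in> borel_measurable (lebesgue_on \<Omega>)" for n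
        by measurable
      have [measurable]: "(indicator (box a b) :: real^'d \<Rightarrow> real) \<in> borel_measurable (lebesgue_on \<Omega>)"
        by (intro measurable_restrict_space1 borel_measurable_indicator) auto
      show "(\<lambda>x. G x * indicator (box a b) x) \<in> borel_measurable (lebesgue_on \<Omega>)"
        by measurable
      show "integrable (lebesgue_on \<Omega>) (\<lambda>x. norm (G x))" using G by simp
      show "AE x in lebesgue_on \<Omega>. (\<lambda>n. G x * box_bump a b n x) \<longlonglongrightarrow> G x * indicator (box a b) x"
        by (intro AE_I2 tendsto_intros box_bump_tendsto)
      show "AE x in lebesgue_on \<Omega>. norm (G x * box_bump a b n x) \<le> norm (G x)" for n
        by (intro AE_I2) (simp add: abs_mult mult_left_le box_bump_bound)
    qed
    then have "integral\<^sup>L (lebesgue_on \<Omega>) (\<lambda>x. G x * indicator (box a b) x) = 0"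
      using zero[OF box_bump_test_function[OF ab]] by (simp add: LIMSEQ_const_iff)
    moreover have "integral\<^sup>L (lebesgue_on \<Omega>) (\<lambda>x. G x * indicator (box a b) x)
        = (LINT x:box a b|lebesgue. G x)"
      unfolding set_lebesgue_integral_def
      using subset_trans[OF box_subset_cbox ab]
      by (subst integral_restrict_space)
         (auto intro!: Bochner_Integration.integral_cong split: split_indicator dest: subsetD)
    ultimately show ?thesis by simp
  qed
  have cbox_AE: "AE x in lebesgue. x \<in> cbox c d \<longrightarrow> G x = 0" if cd: "cbox c d \<subseteq> \<Omega>" for c d
  proof -
    let ?f = "\<lambda>x. indicator (box c d) x * G x"
    have "integrable lebesgue (\<lambda>x. indicator \<Omega> x *\<^sub>R G x)"
      using G by (simp add: integrable_restrict_space)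
    then have "integrable lebesgue (\<lambda>x. indicator (box c d) x *\<^sub>R (indicator \<Omega> x *\<^sub>R G x))"
      by (rule integrable_mult_indicator[rotated]) auto
    also have "(\<lambda>x. indicator (box c d) x *\<^sub>R (indicator \<Omega> x *\<^sub>R G x)) = ?f"
      using subset_trans[OF box_subset_cbox cd] by (intro ext) (auto split: split_indicator)
    finally have f: "integrable lebesgue ?f" .
    have "(LINT x:box a b|lebesgue. ?f x) = 0" for a b
    proof -
      let ?a = "\<Sum>i\<in>Basis. max (a\<bullet>i) (c\<bullet>i) *\<^sub>R i" and ?b = "\<Sum>i\<in>Basis. min (b\<bullet>i) (d\<bullet>i) *\<^sub>R i"
      \<comment> \<open>The box from \<open>?a\<close> to \<open>?b\<close> is the intersection of the two boxes.\<close>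
      have "cbox ?a ?b \<subseteq> cbox c d"
        by (auto simp: mem_box)
      then have "(LINT x:box ?a ?b|lebesgue. G x) = 0"
        using box_zero cd by blast
      then show ?thesis
        unfolding box_Int_box[symmetric] set_lebesgue_integral_def
        by (simp add: indicator_inter_arith mult.assoc)
    qed
    then have "AE x in lebesgue. ?f x = 0"
      by (rule AE_zero_if_box_integrals_zero[OF f])
    moreover have "AE x in lebesgue. x \<notin> cbox c d - box c d"
      using negligible_frontier_interval[of c d] by (intro AE_not_in) (simp only: negligible_iff_null_sets)
    ultimately show ?thesis
      by eventually_elim auto
  qed
  obtain \<D> where \<D>: "countable \<D>" "\<D> \<subseteq> Pow \<Omega>" "\<And>X. X \<in> \<D> \<Longrightarrow> \<exists>a b. X = cbox a b" "\<Union>\<D> = \<Omega>"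
    using open_countable_Union_open_cbox[OF \<Omega>] by blast
  have "AE x in lebesgue. \<forall>X\<in>\<D>. x \<in> X \<longrightarrow> G x = 0"
    unfolding AE_ball_countable[OF \<D>(1)] using cbox_AE \<D>(2,3) by blast
  then have "AE x in lebesgue. x \<in> \<Omega> \<longrightarrow> G x = 0"
    by eventually_elim (use \<D>(4) in blast)
  then show ?thesis
    by (simp add: AE_restrict_space_iff)
qed

section \<open>Integrals of derivatives of test functions\<close>

lemma test_functions_partial_deriv_continuous:
  assumes "\<phi> \<in> test_functions \<Omega>"
  shows "continuous_on UNIV (partial_deriv i \<phi>)"
proof -
  have "Ck_fun (Suc 0) \<phi>" using assms unfolding test_functions_def by blast
  then show ?thesis by simp
qed

lemma test_functions_has_derivative:
  assumes "\<phi> \<in> test_functions \<Omega>"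
  shows "(\<phi> has_derivative frechet_derivative \<phi> (at x)) (at x)"
proof -
  have "Ck_fun (Suc 0) \<phi>" using assms unfolding test_functions_def by blast
  then have "\<phi> differentiable at x" by (simp add: differentiable_on_def)
  then show ?thesis by (simp add: frechet_derivative_works)
qed

text \<open>
  The integral of \<open>\<phi>\<close> over the whole space is invariant under translations, so every difference
  quotient of \<open>\<phi>\<close> in direction \<open>i\<close> has integral zero. By the mean value theorem the quotients are
  bounded by the maximum of the modulus of the partial derivative, and they vanish outside a fixed ball, so
  dominated convergence applies.
\<close>
lemma integral_partial_deriv_test_function:
  fixes \<Omega> :: "(real^'d) set"
  assumes \<Omega>: "open \<Omega>" and \<phi>: "\<phi> \<in> test_functions \<Omega>"
  shows "integral\<^sup>L (lebesgue_on \<Omega>) (partial_deriv i \<phi>) = 0"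
proof -
  define K where "K = closure {x. \<phi> x \<noteq> 0}"
  let ?e = "axis i 1 :: real^'d"
  define D where "D = partial_deriv i \<phi>"
  have K: "compact K" "K \<subseteq> \<Omega>" using \<phi> by (auto simp: test_functions_def K_def)
  have \<phi>_out: "\<phi> x = 0" if "x \<notin> K" for x
    using that closure_subset[of "{x. \<phi> x \<noteq> 0}"] unfolding K_def by auto
  have der: "(\<phi> has_derivative frechet_derivative \<phi> (at x)) (at x)" for x
    using \<phi> by (rule test_functions_has_derivative)
  have D_out: "D x = 0" if "x \<notin> K" for x
  proof -
    have "(\<phi> has_derivative (\<lambda>h. 0)) (at x)"
      by (rule has_derivative_transform_within_open[where s = "- K" and f = "\<lambda>x. 0"])
         (use that \<phi>_out K in \<open>auto intro: compact_imp_closed\<close>)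
    then show ?thesis unfolding D_def by (simp add: partial_deriv_eq)
  qed
  have contD: "continuous_on UNIV D"
    using test_functions_partial_deriv_continuous[OF \<phi>] by (simp add: D_def)
  have cont\<phi>: "continuous_on UNIV \<phi>"
    using der has_derivative_continuous by (blast intro: continuous_at_imp_continuous_on)
  have [measurable]: "D \<in> borel_measurable borel" "\<phi> \<in> borel_measurable borel"
    using contD cont\<phi> by (auto intro: borel_measurable_continuous_onI)
  obtain C where C: "\<And>x. \<bar>D x\<bar> \<le> C" "C \<ge> 0"
  proof -
    have "compact (D ` K)"
      using K contD by (auto intro: compact_continuous_image continuous_on_subset)
    then obtain C where "\<forall>y\<in>D ` K. norm y \<le> C"
      using compact_imp_bounded bounded_iff by blast
    then have "\<bar>D x\<bar> \<le> \<bar>C\<bar>" for x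
      using D_out[of x] by (cases "x \<in> K") fastforce+
    then show ?thesis using that[of "\<bar>C\<bar>"] by simp
  qed
  obtain R where R: "\<And>x. x \<in> K \<Longrightarrow> norm x \<le> R"
    using compact_imp_bounded[OF K(1)] bounded_iff by blast
  have int\<phi>: "integrable lborel \<phi>"
  proof -
    have "set_integrable lborel K \<phi>"
      unfolding set_integrable_def
      using K cont\<phi> by (intro borel_integrable_compact) (auto intro: continuous_on_subset)
    moreover have "(\<lambda>x. indicator K x *\<^sub>R \<phi> x) = \<phi>"
      using \<phi>_out by (auto split: split_indicator)
    ultimately show ?thesis by (simp add: set_integrable_def)
  qed
  define q where "q n x = (\<phi> (inverse (real (Suc n)) *\<^sub>R ?e + x) - \<phi> x) / inverse (real (Suc n))" for n x
  have shift: "integrable lborel (\<lambda>x. \<phi> (c + x))" "(\<integral>x. \<phi> (c + x) \<partial>lborel) = (\<integral>x. \<phi> x \<partial>lborel)" for c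
    using integrable_distr[of "(+) c" lborel borel \<phi>] integral_distr[of "(+) c" lborel borel \<phi>] int\<phi>
    by (simp_all add: lborel_distr_plus)
  have q_int: "(\<integral>x. q n x \<partial>lborel) = 0" for n
    unfolding q_def by (simp add: shift int\<phi> del: of_nat_Suc)
  have line: "((\<lambda>t. \<phi> (t *\<^sub>R ?e + x)) has_real_derivative D (t *\<^sub>R ?e + x)) (at t)" for t x
  proof -
    have "((\<lambda>t. \<phi> (t *\<^sub>R ?e + x)) has_derivative (\<lambda>h. frechet_derivative \<phi> (at (t *\<^sub>R ?e + x)) (h *\<^sub>R ?e))) (at t)"
      by (rule has_derivative_compose[OF _ der]) (auto intro!: derivative_eq_intros)
    moreover have "frechet_derivative \<phi> (at (t *\<^sub>R ?e + x)) (h *\<^sub>R ?e) = D (t *\<^sub>R ?e + x) * h" for h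
      using linear_cmul[OF has_derivative_linear[OF der]] by (simp add: D_def partial_deriv_def)
    ultimately show ?thesis by (simp add: has_field_derivative_def)
  qed
  have q_bound: "\<bar>q n x\<bar> \<le> C" for n x
  proof -
    let ?h = "inverse (real (Suc n))"
    have "?h > 0" by simp
    then obtain z where "\<phi> (?h *\<^sub>R ?e + x) - \<phi> (0 *\<^sub>R ?e + x) = (?h - 0) * D (z *\<^sub>R ?e + x)"
      using MVT2[of 0 ?h "\<lambda>t. \<phi> (t *\<^sub>R ?e + x)" "\<lambda>t. D (t *\<^sub>R ?e + x)"] line by blast
    then have "q n x = D (z *\<^sub>R ?e + x)"
      using \<open>?h > 0\<close> by (simp add: q_def del: of_nat_Suc)
    then show ?thesis using C by simp
  qed
  have q_out: "q n x = 0" if "norm x > R + 1" for n x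
  proof -
    let ?h = "inverse (real (Suc n))"
    have "norm (?h *\<^sub>R ?e) \<le> 1" by (simp add: inverse_le_1_iff)
    then have "norm (?h *\<^sub>R ?e + x) > R"
      using norm_triangle_ineq4[of "?h *\<^sub>R ?e + x" "?h *\<^sub>R ?e"] that by simp
    then have "?h *\<^sub>R ?e + x \<notin> K" "x \<notin> K" using R that by force+
    then show ?thesis by (simp add: q_def \<phi>_out)
  qed
  have "(\<lambda>n. \<integral>x. q n x \<partial>lborel) \<longlonglongrightarrow> (\<integral>x. D x \<partial>lborel)"
  proof (rule integral_dominated_convergence)
    show "q n \<in> borel_measurable lborel" for n unfolding q_def by measurable
    show "D \<in> borel_measurable lborel" by measurable
    \<comment> \<open>The steps have length at most 1, so the support grows at most to the ball of radius \<open>R + 1\<close>.\<close>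
    show "integrable lborel (\<lambda>x. indicator (cball 0 (R + 1)) x * C)"
      by (intro integrable_mult_left integrable_real_indicator) (use emeasure_bounded_finite[OF bounded_cball, of 0 "R + 1"] in auto)
    show "AE x in lborel. norm (q n x) \<le> indicator (cball 0 (R + 1)) x * C" for n
      using q_bound q_out by (intro AE_I2) (auto split: split_indicator)
    show "AE x in lborel. (\<lambda>n. q n x) \<longlonglongrightarrow> D x"
    proof (rule AE_I2)
      fix x :: "real^'d"
      have "((\<lambda>h. (\<phi> ((0 + h) *\<^sub>R ?e + x) - \<phi> (0 *\<^sub>R ?e + x)) / h) \<longlongrightarrow> D (0 *\<^sub>R ?e + x)) (at 0)"
        using line[of x 0] by (simp only: DERIV_def)
      moreover have "filterlim (\<lambda>n. inverse (real (Suc n))) (at 0) sequentially"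
        using LIMSEQ_inverse_real_of_nat by (auto simp: filterlim_at)
      ultimately have "(\<lambda>n. (\<phi> ((0 + inverse (real (Suc n))) *\<^sub>R ?e + x) - \<phi> (0 *\<^sub>R ?e + x)) / inverse (real (Suc n)))
          \<longlonglongrightarrow> D (0 *\<^sub>R ?e + x)"
        by (rule filterlim_compose)
      then show "(\<lambda>n. q n x) \<longlonglongrightarrow> D x" by (simp add: q_def)
    qed
  qed
  then have "(\<integral>x. D x \<partial>lborel) = 0"
    by (simp add: q_int LIMSEQ_const_iff)
  moreover have "D x = 0" if "x \<notin> \<Omega>" for x
    using D_out K(2) that by blast
  then have "integral\<^sup>L (lebesgue_on \<Omega>) D = integral\<^sup>L lebesgue D"
    using \<Omega>
    by (subst integral_restrict_space) (auto intro!: Bochner_Integration.integral_cong split: split_indicator)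
  moreover have "integral\<^sup>L lebesgue D = (\<integral>x. D x \<partial>lborel)"
    by (rule integral_completion) measurable
  ultimately show ?thesis by (simp add: D_def)
qed

section \<open>Square integrable functions and weak gradients\<close>

lemma L2_inner_integrable:
  fixes f g :: "real^'d \<Rightarrow> 'b::euclidean_space"
  assumes f: "f \<in> L2_space \<Omega>" and g: "g \<in> L2_space \<Omega>"
  shows "integrable (lebesgue_on \<Omega>) (\<lambda>x. f x \<bullet> g x)"
proof (rule Bochner_Integration.integrable_bound)
  show "integrable (lebesgue_on \<Omega>) (\<lambda>x. (norm (f x))\<^sup>2 + (norm (g x))\<^sup>2)"
    using assms by (simp add: L2_space_def)
  show "(\<lambda>x. f x \<bullet> g x) \<in> borel_measurable (lebesgue_on \<Omega>)"
    using assms by (auto simp: L2_space_def)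
  have "\<bar>f x \<bullet> g x\<bar> \<le> (norm (f x))\<^sup>2 + (norm (g x))\<^sup>2" for x
  proof -
    have "2 * (norm (f x) * norm (g x)) \<le> (norm (f x))\<^sup>2 + (norm (g x))\<^sup>2"
      using sum_squares_bound[of "norm (f x)" "norm (g x)"] by simp
    moreover have "0 \<le> norm (f x) * norm (g x)" by simp
    ultimately show ?thesis using Cauchy_Schwarz_ineq2[of "f x" "g x"] by linarith
  qed
  then show "AE x in lebesgue_on \<Omega>. norm (f x \<bullet> g x) \<le> norm ((norm (f x))\<^sup>2 + (norm (g x))\<^sup>2)"
    by (intro AE_I2) simp
qed

lemma L2_mult_integrable:
  fixes f g :: "real^'d \<Rightarrow> real"
  assumes "f \<in> L2_space \<Omega>" "g \<in> L2_space \<Omega>"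
  shows "integrable (lebesgue_on \<Omega>) (\<lambda>x. f x * g x)"
  using L2_inner_integrable[OF assms] by simp

lemma L2_lincomb:
  fixes f g :: "real^'d \<Rightarrow> 'b::euclidean_space"
  assumes f: "f \<in> L2_space \<Omega>" and g: "g \<in> L2_space \<Omega>"
  shows "(\<lambda>x. a *\<^sub>R f x + b *\<^sub>R g x) \<in> L2_space \<Omega>"
proof -
  have [measurable]: "f \<in> borel_measurable (lebesgue_on \<Omega>)" "g \<in> borel_measurable (lebesgue_on \<Omega>)"
    using assms by (auto simp: L2_space_def)
  have "(norm (a *\<^sub>R f x + b *\<^sub>R g x))\<^sup>2
      = a\<^sup>2 * (f x \<bullet> f x) + 2 * a * b * (f x \<bullet> g x) + b\<^sup>2 * (g x \<bullet> g x)" for x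
    unfolding power2_norm_eq_inner
    by (simp add: inner_add inner_commute power2_eq_square algebra_simps)
  then have "integrable (lebesgue_on \<Omega>) (\<lambda>x. (norm (a *\<^sub>R f x + b *\<^sub>R g x))\<^sup>2)"
    using assms by (simp add: L2_inner_integrable)
  then show ?thesis by (simp add: L2_space_def)
qed

lemma L2_bounded_mult:
  fixes f :: "real^'d \<Rightarrow> 'b::euclidean_space"
  assumes f: "f \<in> L2_space \<Omega>" and a: "a \<in> borel_measurable (lebesgue_on \<Omega>)"
    and bound: "\<And>x. x \<in> \<Omega> \<Longrightarrow> \<bar>a x\<bar> \<le> C"
  shows "(\<lambda>x. a x *\<^sub>R f x) \<in> L2_space \<Omega>"
proof -
  have [measurable]: "f \<in> borel_measurable (lebesgue_on \<Omega>)" "a \<in> borel_measurable (lebesgue_on \<Omega>)"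
    using assms by (auto simp: L2_space_def)
  have "integrable (lebesgue_on \<Omega>) (\<lambda>x. (norm (a x *\<^sub>R f x))\<^sup>2)"
  proof (rule Bochner_Integration.integrable_bound)
    show "integrable (lebesgue_on \<Omega>) (\<lambda>x. C\<^sup>2 * (norm (f x))\<^sup>2)"
      using f by (simp add: L2_space_def)
    show "AE x in lebesgue_on \<Omega>. norm ((norm (a x *\<^sub>R f x))\<^sup>2) \<le> norm (C\<^sup>2 * (norm (f x))\<^sup>2)"
    proof (rule AE_I2)
      fix x assume "x \<in> space (lebesgue_on \<Omega>)"
      then have "\<bar>a x\<bar>\<^sup>2 \<le> C\<^sup>2" using bound by (intro power_mono) auto
      then show "norm ((norm (a x *\<^sub>R f x))\<^sup>2) \<le> norm (C\<^sup>2 * (norm (f x))\<^sup>2)"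
        by (simp add: power_mult_distrib mult_right_mono)
    qed
  qed measurable
  then show ?thesis by (simp add: L2_space_def)
qed

lemma L2_component:
  fixes G :: "real^'d \<Rightarrow> real^'e"
  assumes "G \<in> L2_space \<Omega>"
  shows "(\<lambda>x. G x $ i) \<in> L2_space \<Omega>"
proof -
  have G_meas: "G \<in> borel_measurable (lebesgue_on \<Omega>)" and
    int: "integrable (lebesgue_on \<Omega>) (\<lambda>x. (norm (G x))\<^sup>2)"
    using assms by (auto simp: L2_space_def)
  have comp: "(\<lambda>x. G x $ i) \<in> borel_measurable (lebesgue_on \<Omega>)"
    by (rule measurable_compose[OF G_meas])
       (intro borel_measurable_continuous_onI continuous_intros)
  have "integrable (lebesgue_on \<Omega>) (\<lambda>x. (norm (G x $ i))\<^sup>2)"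
    using int
    by (rule Bochner_Integration.integrable_bound)
       (use comp component_le_norm_cart in \<open>auto intro!: AE_I2 simp: abs_le_square_iff[symmetric]\<close>)
  then show ?thesis using comp by (simp add: L2_space_def)
qed

locale bounded_open_set =
  fixes \<Omega> :: "(real^'d) set"
  assumes open_domain: "open \<Omega>" and bounded_domain: "bounded \<Omega>"
begin

lemma domain_lmeasurable: "\<Omega> \<in> lmeasurable"
  using open_domain bounded_domain by (simp add: lmeasurable_open)

lemma continuous_on_closure_measurable_bounded:
  fixes f :: "real^'d \<Rightarrow> real"
  assumes "continuous_on (closure \<Omega>) f"
  shows "f \<in> borel_measurable (lebesgue_on \<Omega>)" and "\<exists>C. \<forall>x\<in>\<Omega>. \<bar>f x\<bar> \<le> C"
proof -
  show "f \<in> borel_measurable (lebesgue_on \<Omega>)"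
    using assms domain_lmeasurable closure_subset
    by (intro continuous_imp_measurable_on_sets_lebesgue) (auto intro: continuous_on_subset)
  have "compact (f ` closure \<Omega>)"
    using assms bounded_domain by (intro compact_continuous_image) auto
  then show "\<exists>C. \<forall>x\<in>\<Omega>. \<bar>f x\<bar> \<le> C"
    using compact_imp_bounded[of "f ` closure \<Omega>"] closure_subset[of \<Omega>]
    by (fastforce simp: bounded_iff)
qed

lemma L2_const: "(\<lambda>x. c :: real) \<in> L2_space \<Omega>"
  using finite_measure.integrable_const[OF finite_measure_lebesgue_on[OF domain_lmeasurable], of "c\<^sup>2"]
  by (simp add: L2_space_def)

lemma L2_continuous_mult:
  fixes f :: "real^'d \<Rightarrow> 'b::euclidean_space"
  assumes "continuous_on (closure \<Omega>) a" "f \<in> L2_space \<Omega>"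
  shows "(\<lambda>x. a x *\<^sub>R f x) \<in> L2_space \<Omega>"
  using L2_bounded_mult[OF assms(2)] continuous_on_closure_measurable_bounded[OF assms(1)] by blast

lemma L2_continuous:
  fixes f :: "real^'d \<Rightarrow> real"
  assumes "continuous_on (closure \<Omega>) f"
  shows "f \<in> L2_space \<Omega>"
  using L2_continuous_mult[OF assms L2_const[of 1]] by simp

lemma L2_integrable:
  fixes f :: "real^'d \<Rightarrow> real"
  shows "f \<in> L2_space \<Omega> \<Longrightarrow> integrable (lebesgue_on \<Omega>) f"
  using L2_mult_integrable[OF _ L2_const[of 1]] by simp

lemma test_function_L2: "\<phi> \<in> test_functions \<Omega> \<Longrightarrow> \<phi> \<in> L2_space \<Omega>"
  by (intro L2_continuous continuous_at_imp_continuous_on ballI)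
     (blast intro: has_derivative_continuous test_functions_has_derivative)

lemma test_function_partial_deriv_L2: "\<phi> \<in> test_functions \<Omega> \<Longrightarrow> partial_deriv i \<phi> \<in> L2_space \<Omega>"
  by (intro L2_continuous continuous_on_subset[OF test_functions_partial_deriv_continuous]) auto

text \<open>
  This is what makes the choice of a representative in \<open>weak_grad\<close> immaterial; linearity of the
  weak gradient and the vanishing gradient of constants are consequences.
\<close>
lemma weak_gradient_unique:
  assumes G: "G \<in> L2_space \<Omega>" "is_weak_gradient \<Omega> v G"
    and G': "G' \<in> L2_space \<Omega>" "is_weak_gradient \<Omega> v G'"
  shows "AE x in lebesgue_on \<Omega>. G x = G' x"
proof -
  have "AE x in lebesgue_on \<Omega>. G x $ i - G' x $ i = 0" for i
  proof (rule fundamental_lemma_calculus_of_variations[OF open_domain])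
    show "integrable (lebesgue_on \<Omega>) (\<lambda>x. G x $ i - G' x $ i)"
      using G G' by (intro Bochner_Integration.integrable_diff L2_integrable L2_component)
    fix \<phi> assume \<phi>: "\<phi> \<in> test_functions \<Omega>"
    then have "integral\<^sup>L (lebesgue_on \<Omega>) (\<lambda>x. G x $ i * \<phi> x) = integral\<^sup>L (lebesgue_on \<Omega>) (\<lambda>x. G' x $ i * \<phi> x)"
      using G G' by (simp add: is_weak_gradient_def)
    then show "integral\<^sup>L (lebesgue_on \<Omega>) (\<lambda>x. (G x $ i - G' x $ i) * \<phi> x) = 0"
      using G G' \<phi>
      by (simp add: left_diff_distrib L2_mult_integrable L2_component test_function_L2)
  qed
  then have "AE x in lebesgue_on \<Omega>. \<forall>i. G x $ i - G' x $ i = 0"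
    by (simp add: AE_all_countable)
  then show ?thesis
    by eventually_elim (simp add: vec_eq_iff)
qed

lemma is_weak_gradient_lincomb:
  assumes u: "u \<in> L2_space \<Omega>" "G \<in> L2_space \<Omega>" "is_weak_gradient \<Omega> u G"
    and v: "v \<in> L2_space \<Omega>" "G' \<in> L2_space \<Omega>" "is_weak_gradient \<Omega> v G'"
  shows "is_weak_gradient \<Omega> (\<lambda>x. a * u x + b * v x) (\<lambda>x. a *\<^sub>R G x + b *\<^sub>R G' x)"
  unfolding is_weak_gradient_def
proof (intro ballI allI)
  fix \<phi> i assume \<phi>: "\<phi> \<in> test_functions \<Omega>"
  note [simp] = L2_mult_integrable test_function_L2 test_function_partial_deriv_L2 L2_component
  have "integral\<^sup>L (lebesgue_on \<Omega>) (\<lambda>x. (a * u x + b * v x) * partial_deriv i \<phi> x)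
      = a * integral\<^sup>L (lebesgue_on \<Omega>) (\<lambda>x. u x * partial_deriv i \<phi> x)
        + b * integral\<^sup>L (lebesgue_on \<Omega>) (\<lambda>x. v x * partial_deriv i \<phi> x)"
    using u v \<phi> by (simp add: distrib_right mult.assoc)
  also have "\<dots> = - (a * integral\<^sup>L (lebesgue_on \<Omega>) (\<lambda>x. G x $ i * \<phi> x)
        + b * integral\<^sup>L (lebesgue_on \<Omega>) (\<lambda>x. G' x $ i * \<phi> x))"
    using u v \<phi> by (simp add: is_weak_gradient_def)
  also have "\<dots> = - integral\<^sup>L (lebesgue_on \<Omega>) (\<lambda>x. (a *\<^sub>R G x + b *\<^sub>R G' x) $ i * \<phi> x)"
    using u v \<phi> by (simp add: distrib_right mult.assoc)
  finally show "integral\<^sup>L (lebesgue_on \<Omega>) (\<lambda>x. (a * u x + b * v x) * partial_deriv i \<phi> x)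
      = - integral\<^sup>L (lebesgue_on \<Omega>) (\<lambda>x. (a *\<^sub>R G x + b *\<^sub>R G' x) $ i * \<phi> x)" .
qed

lemma weak_grad_works:
  assumes "v \<in> H1_space \<Omega>"
  shows "weak_grad \<Omega> v \<in> L2_space \<Omega>" "is_weak_gradient \<Omega> v (weak_grad \<Omega> v)"
proof -
  have "\<exists>G. G \<in> L2_space \<Omega> \<and> is_weak_gradient \<Omega> v G"
    using assms by (auto simp: H1_space_def)
  from someI_ex[OF this] show "weak_grad \<Omega> v \<in> L2_space \<Omega>" "is_weak_gradient \<Omega> v (weak_grad \<Omega> v)"
    by (auto simp: weak_grad_def)
qed

lemma H1_imp_L2: "v \<in> H1_space \<Omega> \<Longrightarrow> v \<in> L2_space \<Omega>"
  by (simp add: H1_space_def)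

lemma H1_lincomb:
  assumes "u \<in> H1_space \<Omega>" "v \<in> H1_space \<Omega>"
  shows "(\<lambda>x. a * u x + b * v x) \<in> H1_space \<Omega>"
  using is_weak_gradient_lincomb[of u "weak_grad \<Omega> u" v "weak_grad \<Omega> v" a b]
    L2_lincomb[of u \<Omega> v a b] L2_lincomb[of "weak_grad \<Omega> u" \<Omega> "weak_grad \<Omega> v" a b]
    weak_grad_works[OF assms(1)] weak_grad_works[OF assms(2)] assms
  by (auto simp: H1_space_def)

lemma weak_grad_lincomb:
  assumes "u \<in> H1_space \<Omega>" "v \<in> H1_space \<Omega>"
  shows "AE x in lebesgue_on \<Omega>. weak_grad \<Omega> (\<lambda>x. a * u x + b * v x) x
    = a *\<^sub>R weak_grad \<Omega> u x + b *\<^sub>R weak_grad \<Omega> v x"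
  using assms
  by (intro weak_gradient_unique[where v = "\<lambda>x. a * u x + b * v x"] weak_grad_works H1_lincomb is_weak_gradient_lincomb L2_lincomb H1_imp_L2)
     auto

text \<open>
  Only the values on \<open>\<Omega>\<close> matter for membership in \<open>H\<^sup>1\<close>, whereas the constants of the finite element
  space vanish off the closure of \<open>\<Omega>\<close>; hence the hypothesis is restricted to \<open>\<Omega>\<close>.
\<close>
lemma constant_H1:
  assumes "\<And>x. x \<in> \<Omega> \<Longrightarrow> f x = c"
  shows "f \<in> H1_space \<Omega>" and "AE x in lebesgue_on \<Omega>. weak_grad \<Omega> f x = 0"
proof -
  have "f \<in> borel_measurable (lebesgue_on \<Omega>) \<longleftrightarrow> (\<lambda>x. c) \<in> borel_measurable (lebesgue_on \<Omega>)"
    by (rule measurable_cong) (use assms in auto)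
  moreover have "integrable (lebesgue_on \<Omega>) (\<lambda>x. (norm (f x))\<^sup>2) \<longleftrightarrow> integrable (lebesgue_on \<Omega>) (\<lambda>x. (norm c)\<^sup>2)"
    by (rule Bochner_Integration.integrable_cong) (use assms in auto)
  ultimately have f: "f \<in> L2_space \<Omega>"
    using L2_const[of c] by (simp add: L2_space_def)
  have zero: "(\<lambda>x. 0) \<in> L2_space \<Omega>" by (simp add: L2_space_def)
  have wg: "is_weak_gradient \<Omega> f (\<lambda>x. 0)"
    unfolding is_weak_gradient_def
  proof (intro ballI allI)
    fix \<phi> i assume \<phi>: "\<phi> \<in> test_functions \<Omega>"
    have "integral\<^sup>L (lebesgue_on \<Omega>) (\<lambda>x. f x * partial_deriv i \<phi> x)
        = integral\<^sup>L (lebesgue_on \<Omega>) (\<lambda>x. c * partial_deriv i \<phi> x)"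
      by (rule Bochner_Integration.integral_cong) (use assms in auto)
    then show "integral\<^sup>L (lebesgue_on \<Omega>) (\<lambda>x. f x * partial_deriv i \<phi> x)
        = - integral\<^sup>L (lebesgue_on \<Omega>) (\<lambda>x. 0 $ i * \<phi> x)"
      by (simp add: integral_partial_deriv_test_function[OF open_domain \<phi>])
  qed
  show H1: "f \<in> H1_space \<Omega>" using f zero wg by (auto simp: H1_space_def)
  show "AE x in lebesgue_on \<Omega>. weak_grad \<Omega> f x = 0"
    by (rule weak_gradient_unique[OF weak_grad_works[OF H1] zero wg])
qed

end

section \<open>Linear systems in finitely generated spaces of functions\<close>

definition linear_space :: "('a \<Rightarrow> real) set \<Rightarrow> bool" where
  "linear_space V \<longleftrightarrow> (\<lambda>x. 0) \<in> V \<and> (\<forall>a b. \<forall>u\<in>V. \<forall>v\<in>V. (\<lambda>x. a * u x + b * v x) \<in> V)"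

text \<open>
  The forms of the scheme are additive only where the integrals and weak gradients exist;
  linearity is therefore relative to a set of functions, as one equation for \<open>a u + b v\<close>.
\<close>
definition linear_functional_on :: "('a \<Rightarrow> real) set \<Rightarrow> (('a \<Rightarrow> real) \<Rightarrow> real) \<Rightarrow> bool" where
  "linear_functional_on V f \<longleftrightarrow>
     (\<forall>a b. \<forall>u\<in>V. \<forall>v\<in>V. f (\<lambda>x. a * u x + b * v x) = a * f u + b * f v)"

definition bilinear_form_on ::
    "('a \<Rightarrow> real) set \<Rightarrow> (('a \<Rightarrow> real) \<Rightarrow> ('a \<Rightarrow> real) \<Rightarrow> real) \<Rightarrow> bool" where
  "bilinear_form_on V b \<longleftrightarrow>
     (\<forall>u\<in>V. linear_functional_on V (b u) \<and> linear_functional_on V (\<lambda>v. b v u))"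

definition psd_form_on ::
    "('a \<Rightarrow> real) set \<Rightarrow> (('a \<Rightarrow> real) \<Rightarrow> ('a \<Rightarrow> real) \<Rightarrow> real) \<Rightarrow> bool" where
  "psd_form_on V b \<longleftrightarrow>
     bilinear_form_on V b \<and> (\<forall>u\<in>V. \<forall>v\<in>V. b u v = b v u) \<and> (\<forall>v\<in>V. b v v \<ge> 0)"

lemma linear_space_lincomb:
  "linear_space V \<Longrightarrow> u \<in> V \<Longrightarrow> v \<in> V \<Longrightarrow> (\<lambda>x. a * u x + b * v x) \<in> V"
  by (simp add: linear_space_def)

lemma linear_space_diff: "linear_space V \<Longrightarrow> u \<in> V \<Longrightarrow> v \<in> V \<Longrightarrow> (\<lambda>x. u x - v x) \<in> V"
  using linear_space_lincomb[of V u v 1 "-1"] by simp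

lemma linear_functional_lincomb:
  "linear_functional_on V f \<Longrightarrow> u \<in> V \<Longrightarrow> v \<in> V \<Longrightarrow> f (\<lambda>x. a * u x + b * v x) = a * f u + b * f v"
  by (simp add: linear_functional_on_def)

lemma linear_functional_zero: "linear_space V \<Longrightarrow> linear_functional_on V f \<Longrightarrow> f (\<lambda>x. 0) = 0"
  using linear_functional_lincomb[of V f "\<lambda>x. 0" "\<lambda>x. 0" 0 0] by (simp add: linear_space_def)

lemma linear_functional_diff:
  "linear_functional_on V f \<Longrightarrow> u \<in> V \<Longrightarrow> v \<in> V \<Longrightarrow> f (\<lambda>x. u x - v x) = f u - f v"
  using linear_functional_lincomb[of V f u v 1 "-1"] by simp

lemma bilinear_formD:
  assumes "bilinear_form_on V b" "u \<in> V"
  shows "linear_functional_on V (b u)" "linear_functional_on V (\<lambda>v. b v u)"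
  using assms by (auto simp: bilinear_form_on_def)

lemma psd_formD:
  assumes "psd_form_on V b"
  shows "bilinear_form_on V b" "\<And>u v. u \<in> V \<Longrightarrow> v \<in> V \<Longrightarrow> b u v = b v u" "\<And>v. v \<in> V \<Longrightarrow> b v v \<ge> 0"
  using assms by (auto simp: psd_form_on_def)

lemma linear_space_sum:
  assumes "linear_space V" "finite I" "\<And>i. i \<in> I \<Longrightarrow> e i \<in> V"
  shows "(\<lambda>x. \<Sum>i\<in>I. c i * e i x) \<in> V"
  using assms(2,3)
proof (induction I rule: finite_induct)
  case empty
  then show ?case using assms(1) by (simp add: linear_space_def)
next
  case (insert j I)
  then show ?case
    using linear_space_lincomb[OF assms(1), of "e j" "\<lambda>x. \<Sum>i\<in>I. c i * e i x" "c j" 1] by simp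
qed

lemma linear_functional_sum:
  assumes "linear_space V" "linear_functional_on V f" "finite I" "\<And>i. i \<in> I \<Longrightarrow> e i \<in> V"
  shows "f (\<lambda>x. \<Sum>i\<in>I. c i * e i x) = (\<Sum>i\<in>I. c i * f (e i))"
  using assms(3,4)
proof (induction I rule: finite_induct)
  case empty
  then show ?case using assms by (simp add: linear_functional_zero)
next
  case (insert j I)
  then show ?case
    using linear_functional_lincomb[OF assms(2), of "e j" "\<lambda>x. \<Sum>i\<in>I. c i * e i x" "c j" 1]
      linear_space_sum[OF assms(1), of I e c] by simp
qed

text \<open>
  Induction on the number of generators: the elements of \<open>V\<close> that need no \<open>g j\<close> form a smaller
  space \<open>V0\<close>, and a single further element \<open>v1\<close> of \<open>V\<close>, with a nonzero coefficient at \<open>g j\<close>, accounts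
  for all others.
\<close>
lemma subspace_finitely_generated:
  assumes "finite I" "linear_space V" "\<And>v. v \<in> V \<Longrightarrow> \<exists>c. v = (\<lambda>x. \<Sum>i\<in>I. c i * g i x)"
  shows "\<exists>E. finite E \<and> E \<subseteq> V \<and> (\<forall>v\<in>V. \<exists>c. v = (\<lambda>x. \<Sum>e\<in>E. c e * e x))"
  using assms
proof (induction I arbitrary: V rule: finite_induct)
  case empty
  then show ?case by (intro exI[of _ "{}"]) auto
next
  case (insert j I)
  define V0 where "V0 = {v \<in> V. \<exists>c. v = (\<lambda>x. \<Sum>i\<in>I. c i * g i x)}"
  have "linear_space V0"
    unfolding linear_space_def
  proof (intro conjI allI ballI)
    show "(\<lambda>x. 0) \<in> V0"
      using insert.prems(1) by (auto simp: V0_def linear_space_def intro: exI[of _ "\<lambda>i. 0"])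
    fix a b u v assume "u \<in> V0" "v \<in> V0"
    then obtain c c' where "u \<in> V" "v \<in> V" "u = (\<lambda>x. \<Sum>i\<in>I. c i * g i x)" "v = (\<lambda>x. \<Sum>i\<in>I. c' i * g i x)"
      by (auto simp: V0_def)
    then have "(\<lambda>x. a * u x + b * v x) = (\<lambda>x. \<Sum>i\<in>I. (a * c i + b * c' i) * g i x)"
      by (simp add: sum.distrib sum_distrib_left distrib_right mult.assoc)
    then have "\<exists>d. (\<lambda>x. a * u x + b * v x) = (\<lambda>x. \<Sum>i\<in>I. d i * g i x)"
      by (rule exI[of _ "\<lambda>i. a * c i + b * c' i"])
    then show "(\<lambda>x. a * u x + b * v x) \<in> V0"
      unfolding V0_def
      by (intro CollectI conjI linear_space_lincomb[OF insert.prems(1) \<open>u \<in> V\<close> \<open>v \<in> V\<close>])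
  qed
  then have "\<exists>E. finite E \<and> E \<subseteq> V0 \<and> (\<forall>v\<in>V0. \<exists>c. v = (\<lambda>x. \<Sum>e\<in>E. c e * e x))"
    by (rule insert.IH) (simp add: V0_def)
  then obtain E where E: "finite E" "E \<subseteq> V0" and span: "\<And>v. v \<in> V0 \<Longrightarrow> \<exists>c. v = (\<lambda>x. \<Sum>e\<in>E. c e * e x)"
    by blast
  have "V0 \<subseteq> V" by (auto simp: V0_def)
  show ?case
  proof (cases "V \<subseteq> V0")
    case True
    then show ?thesis using E \<open>V0 \<subseteq> V\<close> by (intro exI[of _ E] conjI ballI span) auto
  next
    case False
    then obtain v1 where v1: "v1 \<in> V" "v1 \<notin> V0" by blast
    then obtain c1 where c1: "v1 = (\<lambda>x. \<Sum>i\<in>insert j I. c1 i * g i x)"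
      using insert.prems(2) by blast
    have "c1 j \<noteq> 0"
    proof
      assume "c1 j = 0"
      then have "v1 = (\<lambda>x. \<Sum>i\<in>I. c1 i * g i x)" using c1 insert.hyps by simp
      then show False using v1 by (auto simp: V0_def)
    qed
    have "\<exists>c. v = (\<lambda>x. \<Sum>e\<in>insert v1 E. c e * e x)" if v: "v \<in> V" for v
    proof -
      obtain c where c: "v = (\<lambda>x. \<Sum>i\<in>insert j I. c i * g i x)"
        using insert.prems(2) v by blast
      define t where "t = c j / c1 j"
      define v0 where "v0 = (\<lambda>x. v x - t * v1 x)"
      have "v0 = (\<lambda>x. \<Sum>i\<in>I. (c i - t * c1 i) * g i x)"
        using \<open>c1 j \<noteq> 0\<close> insert.hyps
        by (simp add: v0_def c c1 t_def sum_subtractf left_diff_distrib sum_distrib_left mult.assoc distrib_left)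
      then have "\<exists>d. v0 = (\<lambda>x. \<Sum>i\<in>I. d i * g i x)"
        by (rule exI[of _ "\<lambda>i. c i - t * c1 i"])
      moreover have "v0 \<in> V"
        using linear_space_lincomb[OF insert.prems(1) v v1(1), of 1 "-t"] by (simp add: v0_def)
      ultimately have "v0 \<in> V0" by (simp add: V0_def)
      then obtain d where d: "v0 = (\<lambda>x. \<Sum>e\<in>E. d e * e x)" using span by blast
      have "v x = (\<Sum>e\<in>insert v1 E. (d(v1 := t)) e * e x)" for x
      proof -
        have "v1 \<notin> E" using E v1 by blast
        then have "(\<Sum>e\<in>insert v1 E. (d(v1 := t)) e * e x) = t * v1 x + (\<Sum>e\<in>E. d e * e x)"
          using E(1) by (simp add: sum.insert) (auto intro: sum.cong)
        also have "\<dots> = t * v1 x + v0 x" using d by simp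
        finally show ?thesis by (simp add: v0_def)
      qed
      then show ?thesis by (intro exI[of _ "d(v1 := t)"] ext)
    qed
    then show ?thesis
      using E v1 \<open>V0 \<subseteq> V\<close> by (intro exI[of _ "insert v1 E"] conjI ballI) auto
  qed
qed

text \<open>
  Induction on the number of functionals. On the kernel of \<open>f j\<close> the induction hypothesis gives the
  coefficients of the others; evaluating at one vector with \<open>f j v0 \<noteq> 0\<close> fixes the coefficient of
  \<open>f j\<close>.
\<close>
lemma functional_combination_of_functionals:
  assumes "finite I" "linear_space V" "\<And>i. i \<in> I \<Longrightarrow> linear_functional_on V (f i)"
    "linear_functional_on V l" "\<And>v. v \<in> V \<Longrightarrow> (\<And>i. i \<in> I \<Longrightarrow> f i v = 0) \<Longrightarrow> l v = 0"
  shows "\<exists>c. \<forall>v\<in>V. l v = (\<Sum>i\<in>I. c i * f i v)"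
  using assms
proof (induction I arbitrary: V rule: finite_induct)
  case empty
  then show ?case by simp
next
  case (insert j I)
  define V0 where "V0 = {v \<in> V. f j v = 0}"
  note fj = linear_functional_lincomb[OF insert.prems(2)[of j, simplified]]
  have "linear_space V0"
    using insert.prems(1) linear_functional_zero[OF insert.prems(1) insert.prems(2)[of j]]
    by (auto simp: V0_def linear_space_def fj)
  moreover have "linear_functional_on V0 (f i)" if "i \<in> I" for i
    using insert.prems(2)[of i] that by (auto simp: V0_def linear_functional_on_def)
  moreover have "linear_functional_on V0 l"
    using insert.prems(3) by (auto simp: V0_def linear_functional_on_def)
  ultimately have "\<exists>c. \<forall>v\<in>V0. l v = (\<Sum>i\<in>I. c i * f i v)"
    by (rule insert.IH) (auto simp: V0_def intro: insert.prems(4))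
  then obtain c where c: "\<And>v. v \<in> V0 \<Longrightarrow> l v = (\<Sum>i\<in>I. c i * f i v)" by blast
  show ?case
  proof (cases "\<exists>v0\<in>V. f j v0 \<noteq> 0")
    case True
    then obtain v0 where v0: "v0 \<in> V" "f j v0 \<noteq> 0" by blast
    define s where "s = (l v0 - (\<Sum>i\<in>I. c i * f i v0)) / f j v0"
    have "l v = (\<Sum>i\<in>insert j I. (c(j := s)) i * f i v)" if v: "v \<in> V" for v
    proof -
      define t where "t = f j v / f j v0"
      define v' where "v' = (\<lambda>x. 1 * v x + (- t) * v0 x)"
      have "f j v' = f j v - t * f j v0"
        unfolding v'_def using fj[OF v v0(1), of 1 "-t"] by simp
      then have "f j v' = 0" using v0 by (simp add: t_def)
      then have "v' \<in> V0"
        using linear_space_lincomb[OF insert.prems(1) v v0(1), of 1 "-t"] by (simp add: V0_def v'_def)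
      then have "l v' = (\<Sum>i\<in>I. c i * f i v')" by (rule c)
      moreover have "l v' = l v - t * l v0"
        unfolding v'_def using linear_functional_lincomb[OF insert.prems(3) v v0(1), of 1 "-t"] by simp
      moreover have "f i v' = f i v - t * f i v0" if "i \<in> I" for i
        unfolding v'_def using linear_functional_lincomb[OF insert.prems(2)[of i] v v0(1), of 1 "-t"] that by simp
      ultimately have "l v - t * l v0 = (\<Sum>i\<in>I. c i * f i v) - t * (\<Sum>i\<in>I. c i * f i v0)"
        by (simp add: right_diff_distrib sum_subtractf sum_distrib_left mult.left_commute)
      then have "l v = (\<Sum>i\<in>I. c i * f i v) + t * (l v0 - (\<Sum>i\<in>I. c i * f i v0))"
        by (simp add: algebra_simps)
      also have "t * (l v0 - (\<Sum>i\<in>I. c i * f i v0)) = s * f j v"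
        by (simp add: t_def s_def)
      also have "(\<Sum>i\<in>I. c i * f i v) = (\<Sum>i\<in>I. (c(j := s)) i * f i v)"
        using insert.hyps by (intro sum.cong) auto
      finally show ?thesis using insert.hyps by (simp add: sum.insert)
    qed
    then show ?thesis by blast
  next
    case False
    then have "l v = (\<Sum>i\<in>insert j I. (c(j := 0)) i * f i v)" if "v \<in> V" for v
    proof -
      have "l v = (\<Sum>i\<in>I. c i * f i v)" using c that False by (simp add: V0_def)
      also have "\<dots> = (\<Sum>i\<in>I. (c(j := 0)) i * f i v)"
        using insert.hyps by (intro sum.cong) auto
      finally show ?thesis using insert.hyps by (simp add: sum.insert)
    qed
    then show ?thesis by blast
  qed
qed

text \<open>
  The quadratic function \<open>t \<mapsto> b (t v + \<psi>) (t v + \<psi>)\<close> would be affine with nonzero slope, hence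
  negative somewhere, if \<open>b v \<psi>\<close> did not vanish.
\<close>
lemma psd_form_null:
  assumes b: "psd_form_on V b" and V: "linear_space V" and v: "v \<in> V" "b v v = 0" and \<psi>: "\<psi> \<in> V"
  shows "b v \<psi> = 0"
proof (rule ccontr)
  assume ne: "b v \<psi> \<noteq> 0"
  \<comment> \<open>The value of \<open>t\<close> at which \<open>2 t b v \<psi> + b \<psi> \<psi>\<close> equals \<open>-1\<close>.\<close>
  define t where "t = - (b \<psi> \<psi> + 1) / (2 * b v \<psi>)"
  let ?z = "\<lambda>x. t * v x + 1 * \<psi> x"
  have z: "?z \<in> V" using V v \<psi> by (intro linear_space_lincomb)
  have "b ?z ?z = t * b v ?z + 1 * b \<psi> ?z"
    by (rule linear_functional_lincomb[OF bilinear_formD(2)[OF psd_formD(1)[OF b] z] v(1) \<psi>])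
  also have "b v ?z = t * b v v + 1 * b v \<psi>"
    by (rule linear_functional_lincomb[OF bilinear_formD(1)[OF psd_formD(1)[OF b] v(1)] v(1) \<psi>])
  also have "b \<psi> ?z = t * b \<psi> v + 1 * b \<psi> \<psi>"
    by (rule linear_functional_lincomb[OF bilinear_formD(1)[OF psd_formD(1)[OF b] \<psi>] v(1) \<psi>])
  finally have "b ?z ?z = 2 * t * b v \<psi> + b \<psi> \<psi>"
    using psd_formD(2)[OF b v(1) \<psi>] v by simp
  also have "\<dots> = -1" using ne by (simp add: t_def field_simps)
  finally show False using psd_formD(3)[OF b z] by simp
qed

locale finite_dim_inner_product_space =
  fixes V :: "('a \<Rightarrow> real) set" and ip :: "('a \<Rightarrow> real) \<Rightarrow> ('a \<Rightarrow> real) \<Rightarrow> real"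
  assumes V: "linear_space V"
    and fin: "\<exists>E. finite E \<and> E \<subseteq> V \<and> (\<forall>v\<in>V. \<exists>c. v = (\<lambda>x. \<Sum>e\<in>E. c e * e x))"
    and ip: "psd_form_on V ip"
    and ip_definite: "\<And>v. v \<in> V \<Longrightarrow> ip v v = 0 \<Longrightarrow> v = (\<lambda>x. 0)"
begin

text \<open>
  Nondegeneracy in the second argument says that the functionals \<open>b e\<close>, with \<open>e\<close> ranging over a finite
  generating set, have no common zero but 0; so \<open>l\<close> is a combination of them. Working with a
  generating set and this one-sided condition avoids bases and dimensions.
\<close>
lemma nondegenerate_form_represents_functional:
  assumes b: "bilinear_form_on V b" and l: "linear_functional_on V l"
    and nondeg: "\<And>\<phi>. \<phi> \<in> V \<Longrightarrow> (\<And>v. v \<in> V \<Longrightarrow> b v \<phi> = 0) \<Longrightarrow> \<phi> = (\<lambda>x. 0)"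
  shows "\<exists>u\<in>V. \<forall>\<phi>\<in>V. b u \<phi> = l \<phi>"
proof -
  obtain E where E: "finite E" "E \<subseteq> V" and span: "\<And>v. v \<in> V \<Longrightarrow> \<exists>c. v = (\<lambda>x. \<Sum>e\<in>E. c e * e x)"
    using fin by blast
  have sum: "b (\<lambda>x. \<Sum>e\<in>E. c e * e x) \<phi> = (\<Sum>e\<in>E. c e * b e \<phi>)" if "\<phi> \<in> V" for c \<phi>
    using linear_functional_sum[OF V bilinear_formD(2)[OF b that] E(1), of "\<lambda>e. e" c] E by auto
  have "l \<phi> = 0" if \<phi>: "\<phi> \<in> V" and zero: "\<And>e. e \<in> E \<Longrightarrow> b e \<phi> = 0" for \<phi>
  proof -
    have "b v \<phi> = 0" if "v \<in> V" for v
      using span[OF that] zero by (auto simp: sum[OF \<phi>])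
    then have "\<phi> = (\<lambda>x. 0)" using nondeg \<phi> by blast
    then show ?thesis using linear_functional_zero[OF V l] by simp
  qed
  then obtain c where c: "\<And>\<phi>. \<phi> \<in> V \<Longrightarrow> l \<phi> = (\<Sum>e\<in>E. c e * b e \<phi>)"
    using functional_combination_of_functionals[OF E(1) V, of b l] l E bilinear_formD(1)[OF b] by blast
  have "(\<lambda>x. \<Sum>e\<in>E. c e * e x) \<in> V"
    using linear_space_sum[OF V E(1), of "\<lambda>e. e" c] E by auto
  then show ?thesis using sum c by auto
qed

lemma orthogonal_imp_zero: "\<phi> \<in> V \<Longrightarrow> (\<And>v. v \<in> V \<Longrightarrow> ip v \<phi> = 0) \<Longrightarrow> \<phi> = (\<lambda>x. 0)"
  using ip_definite by blast

lemma riesz: "linear_functional_on V l \<Longrightarrow> \<exists>u\<in>V. \<forall>\<phi>\<in>V. ip u \<phi> = l \<phi>"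
  by (rule nondegenerate_form_represents_functional[OF psd_formD(1)[OF ip]]) (auto intro: orthogonal_imp_zero)

lemma riesz_unique:
  assumes "u \<in> V" "v \<in> V" "\<And>\<phi>. \<phi> \<in> V \<Longrightarrow> ip u \<phi> = ip v \<phi>"
  shows "u = v"
proof -
  have "ip \<phi> (\<lambda>x. u x - v x) = 0" if "\<phi> \<in> V" for \<phi>
    using assms that psd_formD(2)[OF ip]
      linear_functional_diff[OF bilinear_formD(1)[OF psd_formD(1)[OF ip] that] assms(1,2)] by simp
  then have "(\<lambda>x. u x - v x) = (\<lambda>x. 0)"
    using assms by (intro orthogonal_imp_zero linear_space_diff V)
  then show ?thesis by (auto simp: fun_eq_iff)
qed

text \<open>
  The difference \<open>(p, q)\<close> of two solutions solves the homogeneous system. Testing with \<open>\<phi> = q\<close> and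
  \<open>\<psi> = p\<close> gives \<open>a p p + \<tau> k q q = 0\<close>, so \<open>a p\<close> is the zero functional and \<open>q = 0\<close>; then \<open>p = 0\<close>.
\<close>
lemma mixed_system_unique:
  assumes k: "psd_form_on V k" and a: "psd_form_on V a" and \<tau>: "\<tau> > 0"
    and uw: "u \<in> V" "w \<in> V" "u' \<in> V" "w' \<in> V"
    and eqs: "\<And>\<phi>. \<phi> \<in> V \<Longrightarrow> ip u \<phi> + \<tau> * k w \<phi> = l \<phi>" "\<And>\<psi>. \<psi> \<in> V \<Longrightarrow> ip w \<psi> = a u \<psi> + g \<psi>"
    and eqs': "\<And>\<phi>. \<phi> \<in> V \<Longrightarrow> ip u' \<phi> + \<tau> * k w' \<phi> = l \<phi>" "\<And>\<psi>. \<psi> \<in> V \<Longrightarrow> ip w' \<psi> = a u' \<psi> + g \<psi>"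
  shows "u = u' \<and> w = w'"
proof -
  define p where "p = (\<lambda>x. u x - u' x)"
  define q where "q = (\<lambda>x. w x - w' x)"
  have p: "p \<in> V" and q: "q \<in> V"
    using uw V by (auto simp: p_def q_def intro: linear_space_diff)
  note lin = linear_functional_diff[OF bilinear_formD(2)[OF psd_formD(1)]]
  have eq1: "ip p \<phi> + \<tau> * k q \<phi> = 0" if "\<phi> \<in> V" for \<phi>
    using eqs(1)[OF that] eqs'(1)[OF that] lin[OF ip that uw(1,3)] lin[OF k that uw(2,4)]
    by (simp add: p_def q_def right_diff_distrib)
  have eq2: "ip q \<psi> = a p \<psi>" if "\<psi> \<in> V" for \<psi>
    using eqs(2)[OF that] eqs'(2)[OF that] lin[OF a that uw(1,3)] lin[OF ip that uw(2,4)]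
    by (simp add: p_def q_def right_diff_distrib)
  have "a p p + \<tau> * k q q = 0"
    using eq1[OF q] eq2[OF p] psd_formD(2)[OF ip p q] by simp
  moreover have "\<tau> * k q q \<ge> 0" using psd_formD(3)[OF k q] \<tau> by simp
  ultimately have "a p p = 0" using psd_formD(3)[OF a p] by linarith
  then have "ip q \<psi> = 0" if "\<psi> \<in> V" for \<psi>
    using psd_form_null[OF a V p _ that] eq2[OF that] by simp
  then have q0: "q = (\<lambda>x. 0)" using q ip_definite by blast
  have "k q \<phi> = 0" if "\<phi> \<in> V" for \<phi>
    using linear_functional_zero[OF V bilinear_formD(2)[OF psd_formD(1)[OF k] that]] q0 by simp
  then have "p = (\<lambda>x. 0)" using eq1[OF p] p ip_definite by simp
  with q0 show ?thesis by (auto simp: p_def q_def fun_eq_iff)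
qed

text \<open>
  Let \<open>S\<close> and \<open>K\<close> be the operators that represent \<open>a\<close> and \<open>k\<close> in the inner product, and \<open>w0\<close> the
  representative of \<open>g\<close>. With \<open>w = S u + w0\<close> the second equation holds, and the first one becomes
  \<open>b u \<phi> = l \<phi> - \<tau> k w0 \<phi>\<close> for the form \<open>b v \<phi> = ip v \<phi> + \<tau> k (S v) \<phi> = ip v \<phi> + \<tau> a v (K \<phi>)\<close>.
  The two expressions for \<open>b\<close> agree because both last terms are \<open>\<tau> ip (S v) (K \<phi>)\<close>.
  The form is nondegenerate in \<open>\<phi>\<close>: for \<open>v = K \<phi>\<close> it equals \<open>k \<phi> \<phi> + \<tau> a (K \<phi>) (K \<phi>)\<close>.
\<close>
lemma mixed_system_solvable:
  assumes k: "psd_form_on V k" and a: "psd_form_on V a" and \<tau>: "\<tau> > 0"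
    and l: "linear_functional_on V l" and g: "linear_functional_on V g"
  shows "\<exists>u\<in>V. \<exists>w\<in>V. (\<forall>\<phi>\<in>V. ip u \<phi> + \<tau> * k w \<phi> = l \<phi>) \<and> (\<forall>\<psi>\<in>V. ip w \<psi> = a u \<psi> + g \<psi>)"
proof -
  have operator: "\<exists>S. \<forall>v\<in>V. S v \<in> V \<and> (\<forall>\<psi>\<in>V. ip (S v) \<psi> = b v \<psi>)" if "psd_form_on V b" for b
  proof (rule bchoice, rule ballI)
    fix v assume "v \<in> V"
    then show "\<exists>s. s \<in> V \<and> (\<forall>\<psi>\<in>V. ip s \<psi> = b v \<psi>)"
      using riesz[OF bilinear_formD(1)[OF psd_formD(1)[OF that]]] by blast
  qed
  obtain S where S: "\<And>v. v \<in> V \<Longrightarrow> S v \<in> V" "\<And>v \<psi>. v \<in> V \<Longrightarrow> \<psi> \<in> V \<Longrightarrow> ip (S v) \<psi> = a v \<psi>"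
    using operator[OF a] by blast
  obtain K where K: "\<And>v. v \<in> V \<Longrightarrow> K v \<in> V" "\<And>v \<psi>. v \<in> V \<Longrightarrow> \<psi> \<in> V \<Longrightarrow> ip (K v) \<psi> = k v \<psi>"
    using operator[OF k] by blast
  obtain w0 where w0: "w0 \<in> V" "\<And>\<psi>. \<psi> \<in> V \<Longrightarrow> ip w0 \<psi> = g \<psi>"
    using riesz[OF g] by blast
  have kS: "k (S v) \<phi> = a v (K \<phi>)" if "v \<in> V" "\<phi> \<in> V" for v \<phi>
    using that S K psd_formD(2)[OF k, of "S v" \<phi>] psd_formD(2)[OF ip, of "S v" "K \<phi>"] by simp
  \<comment> \<open>The two expressions for \<open>b\<close> yield its linearity in the second and in the first argument.\<close>
  define b where "b v \<phi> = ip v \<phi> + \<tau> * k (S v) \<phi>" for v \<phi>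
  have "bilinear_form_on V b"
    unfolding bilinear_form_on_def
  proof (intro ballI conjI)
    fix v assume v: "v \<in> V"
    show "linear_functional_on V (b v)"
      using bilinear_formD(1)[OF psd_formD(1)[OF ip] v] bilinear_formD(1)[OF psd_formD(1)[OF k] S(1)[OF v]]
      by (simp add: linear_functional_on_def b_def algebra_simps)
    have "b u v = ip u v + \<tau> * a u (K v)" if "u \<in> V" for u
      using kS that v by (simp add: b_def)
    then show "linear_functional_on V (\<lambda>u. b u v)"
      using bilinear_formD(2)[OF psd_formD(1)[OF ip] v] bilinear_formD(2)[OF psd_formD(1)[OF a] K(1)[OF v]]
        linear_space_lincomb[OF V]
      by (simp add: linear_functional_on_def algebra_simps)
  qed
  moreover have "linear_functional_on V (\<lambda>\<phi>. l \<phi> - \<tau> * k w0 \<phi>)"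
    using l bilinear_formD(1)[OF psd_formD(1)[OF k] w0(1)]
    by (simp add: linear_functional_on_def algebra_simps)
  moreover have "\<phi> = (\<lambda>x. 0)" if \<phi>: "\<phi> \<in> V" and zero: "\<And>v. v \<in> V \<Longrightarrow> b v \<phi> = 0" for \<phi>
  proof (rule orthogonal_imp_zero[OF \<phi>])
    have "k \<phi> \<phi> + \<tau> * a (K \<phi>) (K \<phi>) = 0"
      using zero[OF K(1)[OF \<phi>]] \<phi> K kS by (simp add: b_def)
    moreover have "\<tau> * a (K \<phi>) (K \<phi>) \<ge> 0" using psd_formD(3)[OF a K(1)[OF \<phi>]] \<tau> by simp
    ultimately have "\<tau> * a (K \<phi>) (K \<phi>) = 0" using psd_formD(3)[OF k \<phi>] by linarith
    then have null: "a (K \<phi>) (K \<phi>) = 0" using \<tau> by simp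
    fix v assume v: "v \<in> V"
    have "a v (K \<phi>) = 0"
      using psd_form_null[OF a V K(1)[OF \<phi>] null v] psd_formD(2)[OF a v K(1)[OF \<phi>]] by simp
    then show "ip v \<phi> = 0" using zero[OF v] kS[OF v \<phi>] by (simp add: b_def)
  qed
  ultimately obtain u where u: "u \<in> V" "\<And>\<phi>. \<phi> \<in> V \<Longrightarrow> b u \<phi> = l \<phi> - \<tau> * k w0 \<phi>"
    using nondegenerate_form_represents_functional by blast
  define w where "w = (\<lambda>x. 1 * S u x + 1 * w0 x)"
  have w: "w \<in> V" unfolding w_def using V S(1)[OF u(1)] w0(1) by (rule linear_space_lincomb)
  have lin: "c w \<psi> = c (S u) \<psi> + c w0 \<psi>" if "psd_form_on V c" "\<psi> \<in> V" for c \<psi>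
    unfolding w_def
    using linear_functional_lincomb[OF bilinear_formD(2)[OF psd_formD(1)[OF that(1)] that(2)] S(1)[OF u(1)] w0(1), of 1 1]
    by simp
  have "ip u \<phi> + \<tau> * k w \<phi> = l \<phi>" if "\<phi> \<in> V" for \<phi>
    using u(2)[OF that] lin[OF k that] by (simp add: b_def algebra_simps)
  moreover have "ip w \<psi> = a u \<psi> + g \<psi>" if "\<psi> \<in> V" for \<psi>
    using lin[OF ip that] S(2)[OF u(1) that] w0(2)[OF that] by simp
  ultimately show ?thesis using u(1) w by blast
qed

end

section \<open>The bilinear forms of the scheme\<close>

lemma inner_L2_commute: "inner_L2 \<Omega> f g = inner_L2 \<Omega> g f"
  by (simp add: inner_L2_def mult.commute)

lemma inner_L2_lincomb_left:
  assumes "f \<in> L2_space \<Omega>" "g \<in> L2_space \<Omega>" "\<phi> \<in> L2_space \<Omega>"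
  shows "inner_L2 \<Omega> (\<lambda>x. a * f x + b * g x) \<phi> = a * inner_L2 \<Omega> f \<phi> + b * inner_L2 \<Omega> g \<phi>"
  using assms by (simp add: inner_L2_def distrib_right mult.assoc L2_mult_integrable)

lemma inner_L2_lincomb_right:
  assumes "f \<in> L2_space \<Omega>" "g \<in> L2_space \<Omega>" "\<phi> \<in> L2_space \<Omega>"
  shows "inner_L2 \<Omega> \<phi> (\<lambda>x. a * f x + b * g x) = a * inner_L2 \<Omega> \<phi> f + b * inner_L2 \<Omega> \<phi> g"
  using inner_L2_lincomb_left[OF assms] by (simp add: inner_L2_commute)

lemma inner_L2_cong:
  "(\<And>x. x \<in> \<Omega> \<Longrightarrow> f x * g x = f' x * g' x) \<Longrightarrow> inner_L2 \<Omega> f g = inner_L2 \<Omega> f' g'"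
  unfolding inner_L2_def by (rule Bochner_Integration.integral_cong) auto

lemma inner_L2_self_nonneg: "inner_L2 \<Omega> f f \<ge> 0"
  by (simp add: inner_L2_def)

context bounded_open_set
begin

text \<open>
  The set of points of \<open>\<Omega>\<close> where \<open>v\<close> is nonzero is open and negligible, hence empty; continuity
  extends the conclusion to the boundary.
\<close>
lemma inner_L2_definite:
  assumes v: "continuous_on (closure \<Omega>) v" and zero: "inner_L2 \<Omega> v v = 0" and x: "x \<in> closure \<Omega>"
  shows "v x = 0"
proof -
  have "AE x in lebesgue_on \<Omega>. v x * v x = 0"
    using zero integral_nonneg_eq_0_iff_AE[OF L2_mult_integrable[OF L2_continuous[OF v] L2_continuous[OF v]]]
    by (simp add: inner_L2_def)
  then have "AE x in lebesgue. \<not> (x \<in> \<Omega> \<and> v x \<noteq> 0)"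
    using open_domain by (simp add: AE_restrict_space_iff)
  moreover have "{x \<in> \<Omega>. v x \<noteq> 0} = \<Omega> \<inter> v -` (- {0})" by auto
  moreover have "open (\<Omega> \<inter> v -` (- {0}))"
    using v open_domain closure_subset
    by (intro continuous_open_preimage) (auto intro: continuous_on_subset)
  ultimately have "negligible {x \<in> \<Omega>. v x \<noteq> 0}" and "open {x \<in> \<Omega>. v x \<noteq> 0}"
    by (auto simp: negligible_iff_null_sets AE_iff_null_sets)
  then have "{x \<in> \<Omega>. v x \<noteq> 0} = {}"
    using open_not_negligible by blast
  then show ?thesis
    using continuous_constant_on_closure[OF v _ x, of 0] by blast
qed

lemma A_form_integrable:
  assumes "continuous_on (closure \<Omega>) a" "q \<in> H1_space \<Omega>" "v \<in> H1_space \<Omega>"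
  shows "integrable (lebesgue_on \<Omega>) (\<lambda>x. a x * (weak_grad \<Omega> q x \<bullet> weak_grad \<Omega> v x))"
  using L2_inner_integrable[OF L2_continuous_mult[OF assms(1) weak_grad_works(1)[OF assms(2)]]
      weak_grad_works(1)[OF assms(3)]] by simp

lemma A_form_commute: "A_form \<Omega> a q v = A_form \<Omega> a v q"
  by (simp add: A_form_def inner_commute)

text \<open>
  The integrands agree only almost everywhere, because \<open>weak_grad\<close> is linear only up to null sets.
\<close>
lemma A_form_lincomb_left:
  assumes a: "continuous_on (closure \<Omega>) a" and H1: "q \<in> H1_space \<Omega>" "r \<in> H1_space \<Omega>" "v \<in> H1_space \<Omega>"
  shows "A_form \<Omega> a (\<lambda>x. s * q x + t * r x) v = s * A_form \<Omega> a q v + t * A_form \<Omega> a r v"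
proof -
  let ?I = "\<lambda>q x. a x * (weak_grad \<Omega> q x \<bullet> weak_grad \<Omega> v x)"
  note int = A_form_integrable[OF a _ H1(3)]
  have "A_form \<Omega> a (\<lambda>x. s * q x + t * r x) v = integral\<^sup>L (lebesgue_on \<Omega>) (\<lambda>x. s * ?I q x + t * ?I r x)"
    unfolding A_form_def
  proof (rule integral_cong_AE)
    show "?I (\<lambda>x. s * q x + t * r x) \<in> borel_measurable (lebesgue_on \<Omega>)"
      using int[OF H1_lincomb] H1 by blast
    show "(\<lambda>x. s * ?I q x + t * ?I r x) \<in> borel_measurable (lebesgue_on \<Omega>)"
      by (intro borel_measurable_add borel_measurable_times[OF borel_measurable_const]
          borel_measurable_integrable int H1)
    show "AE x in lebesgue_on \<Omega>. ?I (\<lambda>x. s * q x + t * r x) x = s * ?I q x + t * ?I r x"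
      using weak_grad_lincomb[OF H1(1,2), of s t]
      by eventually_elim (simp add: inner_add_left algebra_simps)
  qed
  also have "\<dots> = s * A_form \<Omega> a q v + t * A_form \<Omega> a r v"
    using int[OF H1(1)] int[OF H1(2)] by (simp add: A_form_def)
  finally show ?thesis .
qed

lemma A_form_nonneg:
  assumes "\<And>x. x \<in> \<Omega> \<Longrightarrow> a x \<ge> 0"
  shows "A_form \<Omega> a v v \<ge> 0"
  unfolding A_form_def by (rule integral_nonneg_AE) (use assms in \<open>auto intro!: AE_I2\<close>)

lemma A_form_constant:
  assumes "\<And>x. x \<in> \<Omega> \<Longrightarrow> f x = c"
  shows "A_form \<Omega> a w f = 0"
proof -
  have "AE x in lebesgue_on \<Omega>. weak_grad \<Omega> f x = 0"
    using assms by (rule constant_H1(2))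
  then have "AE x in lebesgue_on \<Omega>. a x * (weak_grad \<Omega> w x \<bullet> weak_grad \<Omega> f x) = 0"
    by eventually_elim simp
  then show ?thesis unfolding A_form_def by (rule integral_eq_zero_AE)
qed

lemma inner_L2_psd_form:
  assumes "\<And>v. v \<in> V \<Longrightarrow> v \<in> L2_space \<Omega>"
  shows "psd_form_on V (inner_L2 \<Omega>)"
  using assms inner_L2_self_nonneg
  by (auto simp: psd_form_on_def bilinear_form_on_def linear_functional_on_def
      inner_L2_lincomb_left inner_L2_lincomb_right intro: inner_L2_commute)

lemma A_form_psd_form:
  assumes "continuous_on (closure \<Omega>) a" "\<And>x. x \<in> \<Omega> \<Longrightarrow> a x \<ge> 0" "\<And>v. v \<in> V \<Longrightarrow> v \<in> H1_space \<Omega>"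
  shows "psd_form_on V (A_form \<Omega> a)"
proof -
  have "A_form \<Omega> a v (\<lambda>x. s * q x + t * r x) = s * A_form \<Omega> a v q + t * A_form \<Omega> a v r"
    if "q \<in> V" "r \<in> V" "v \<in> V" for q r v s t
    using A_form_lincomb_left[of a q r v s t] that assms by (simp add: A_form_commute[of a v])
  then show ?thesis
    using assms A_form_lincomb_left A_form_nonneg
    by (auto simp: psd_form_on_def bilinear_form_on_def linear_functional_on_def intro: A_form_commute)
qed

end

section \<open>The finite element space\<close>

lemma finite_multi_indices: "finite {\<alpha> :: 'd::finite \<Rightarrow> nat. (\<Sum>i\<in>UNIV. \<alpha> i) \<le> k}"
proof (rule finite_subset)
  show "{\<alpha> :: 'd \<Rightarrow> nat. (\<Sum>i\<in>UNIV. \<alpha> i) \<le> k}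
      \<subseteq> {\<alpha>. \<forall>i. (i \<in> UNIV \<longrightarrow> \<alpha> i \<in> {..k}) \<and> (i \<notin> UNIV \<longrightarrow> \<alpha> i = 0)}"
  proof clarify
    fix \<alpha> :: "'d \<Rightarrow> nat" and i
    assume "(\<Sum>i\<in>UNIV. \<alpha> i) \<le> k"
    moreover have "\<alpha> i \<le> (\<Sum>i\<in>UNIV. \<alpha> i)" by (rule member_le_sum) auto
    ultimately show "(i \<in> UNIV \<longrightarrow> \<alpha> i \<in> {..k}) \<and> (i \<notin> UNIV \<longrightarrow> \<alpha> i = 0)" by simp
  qed
  show "finite {\<alpha> :: 'd \<Rightarrow> nat. \<forall>i. (i \<in> UNIV \<longrightarrow> \<alpha> i \<in> {..k}) \<and> (i \<notin> UNIV \<longrightarrow> \<alpha> i = 0)}"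
    by (rule finite_set_of_finite_funs) auto
qed

lemma Pk_lincomb:
  assumes "p \<in> Pk k" "q \<in> Pk k"
  shows "(\<lambda>x. a * p x + b * q x) \<in> Pk k"
proof -
  obtain c c' where "\<And>x. p x = (\<Sum>\<alpha> | (\<Sum>i\<in>UNIV. \<alpha> i) \<le> k. c \<alpha> * (\<Prod>i\<in>UNIV. (x $ i) ^ \<alpha> i))"
    "\<And>x. q x = (\<Sum>\<alpha> | (\<Sum>i\<in>UNIV. \<alpha> i) \<le> k. c' \<alpha> * (\<Prod>i\<in>UNIV. (x $ i) ^ \<alpha> i))"
    using assms by (auto simp: Pk_def)
  then have "\<forall>x. a * p x + b * q x
      = (\<Sum>\<alpha> | (\<Sum>i\<in>UNIV. \<alpha> i) \<le> k. (a * c \<alpha> + b * c' \<alpha>) * (\<Prod>i\<in>UNIV. (x $ i) ^ \<alpha> i))"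
    by (simp add: sum.distrib sum_distrib_left distrib_right mult.assoc)
  then show ?thesis
    unfolding Pk_def by (intro CollectI exI[of _ "\<lambda>\<alpha>. a * c \<alpha> + b * c' \<alpha>"])
qed

lemma Pk_const: "(\<lambda>x. c) \<in> Pk k"
proof -
  have "(\<Sum>\<alpha> :: 'a \<Rightarrow> nat | (\<Sum>i\<in>UNIV. \<alpha> i) \<le> k. (if \<alpha> = (\<lambda>i. 0) then c else 0) * (\<Prod>i\<in>UNIV. (x $ i) ^ \<alpha> i)) = c"
    for x :: "real^'a"
  proof -
    have "(\<Sum>\<alpha> :: 'a \<Rightarrow> nat | (\<Sum>i\<in>UNIV. \<alpha> i) \<le> k. (if \<alpha> = (\<lambda>i. 0) then c else 0) * (\<Prod>i\<in>UNIV. (x $ i) ^ \<alpha> i))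
        = (\<Sum>\<alpha> :: 'a \<Rightarrow> nat | (\<Sum>i\<in>UNIV. \<alpha> i) \<le> k. if \<alpha> = (\<lambda>i. 0) then c else 0)"
      by (rule sum.cong) auto
    also have "\<dots> = c" using finite_multi_indices by (subst sum.delta) auto
    finally show ?thesis .
  qed
  then show ?thesis
    unfolding Pk_def by (intro CollectI exI[of _ "\<lambda>\<alpha>. if \<alpha> = (\<lambda>i. 0) then c else 0"]) simp
qed

lemma FE_space_continuous: "v \<in> FE_space \<Omega> \<T> k \<Longrightarrow> continuous_on (closure \<Omega>) v"
  by (simp add: FE_space_def C0_def)

lemma FE_space_outside: "v \<in> FE_space \<Omega> \<T> k \<Longrightarrow> x \<notin> closure \<Omega> \<Longrightarrow> v x = 0"
  by (simp add: FE_space_def C0_def)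

lemma FE_space_H1: "v \<in> FE_space \<Omega> \<T> k \<Longrightarrow> v \<in> H1_space \<Omega>"
  by (simp add: FE_space_def)

context bounded_open_set
begin

lemma FE_space_indicator:
  assumes "triangulates \<T> \<Omega>"
  shows "(\<lambda>x. if x \<in> closure \<Omega> then c else 0) \<in> FE_space \<Omega> \<T> k"
proof -
  have "continuous_on (closure \<Omega>) (\<lambda>x. if x \<in> closure \<Omega> then c else 0)"
    using continuous_on_const[of "closure \<Omega>" c] by (rule continuous_on_eq) simp
  moreover have "(\<lambda>x. if x \<in> closure \<Omega> then c else 0) \<in> H1_space \<Omega>"
    by (rule constant_H1(1)[of _ c]) (use closure_subset in auto)
  moreover have "\<exists>p\<in>Pk k. \<forall>x\<in>T. (if x \<in> closure \<Omega> then c else 0) = p x" if "T \<in> \<T>" for T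
    using that assms by (intro bexI[OF _ Pk_const[of c]]) (auto simp: triangulates_def)
  ultimately show ?thesis by (simp add: FE_space_def C0_def)
qed

lemma FE_space_linear_space:
  assumes "triangulates \<T> \<Omega>"
  shows "linear_space (FE_space \<Omega> \<T> k)"
  unfolding linear_space_def
proof (intro conjI allI ballI)
  show "(\<lambda>x. 0) \<in> FE_space \<Omega> \<T> k"
    using FE_space_indicator[OF assms, of 0] by simp
  fix a b u v assume uv: "u \<in> FE_space \<Omega> \<T> k" "v \<in> FE_space \<Omega> \<T> k"
  have "\<exists>p\<in>Pk k. \<forall>x\<in>T. a * u x + b * v x = p x" if T: "T \<in> \<T>" for T
  proof -
    obtain p q where "p \<in> Pk k" "q \<in> Pk k" "\<forall>x\<in>T. u x = p x" "\<forall>x\<in>T. v x = q x"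
      using uv T by (fastforce simp: FE_space_def)
    then show ?thesis by (intro bexI[OF _ Pk_lincomb[of p k q a b]]) auto
  qed
  moreover have "continuous_on (closure \<Omega>) (\<lambda>x. a * u x + b * v x)"
    using uv by (intro continuous_intros FE_space_continuous)
  ultimately show "(\<lambda>x. a * u x + b * v x) \<in> FE_space \<Omega> \<T> k"
    using uv H1_lincomb[of u v a b] by (simp add: FE_space_def C0_def)
qed

text \<open>
  A point on a common face lies in several cells, so each point is assigned to one cell that
  contains it. The monomials cut off to the points assigned to a cell generate a space of possibly
  discontinuous functions, of which the finite element space is a subspace.
\<close>
lemma FE_space_finitely_generated:
  fixes k :: nat
  assumes T: "triangulates \<T> \<Omega>"
  defines "V \<equiv> FE_space \<Omega> \<T> k"
  shows "\<exists>E. finite E \<and> E \<subseteq> V \<and> (\<forall>v\<in>V. \<exists>c. v = (\<lambda>x. \<Sum>e\<in>E. c e * e x))"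
proof -
  define A where "A = {\<alpha> :: 'd \<Rightarrow> nat. (\<Sum>i\<in>UNIV. \<alpha> i) \<le> k}"
  define cell where "cell x = (SOME T. T \<in> \<T> \<and> x \<in> T)" for x
  define g where "g = (\<lambda>(T, \<alpha>) x. if x \<in> closure \<Omega> \<and> cell x = T then \<Prod>i\<in>UNIV. (x $ i) ^ \<alpha> i else (0::real))"
  have cell: "cell x \<in> \<T> \<and> x \<in> cell x" if "x \<in> closure \<Omega>" for x
  proof -
    have "\<exists>T. T \<in> \<T> \<and> x \<in> T" using that T by (auto simp: triangulates_def)
    then show ?thesis unfolding cell_def by (rule someI_ex)
  qed
  have fin: "finite \<T>" using T by (simp add: triangulates_def triangulation_def)
  have finA: "finite A" unfolding A_def by (rule finite_multi_indices)
  have "\<exists>c. v = (\<lambda>x. \<Sum>i\<in>\<T> \<times> A. c i * g i x)" if v: "v \<in> V" for v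
  proof -
    have "\<forall>T\<in>\<T>. \<exists>c. \<forall>x\<in>T. v x = (\<Sum>\<alpha>\<in>A. c \<alpha> * (\<Prod>i\<in>UNIV. (x $ i) ^ \<alpha> i))"
      using v by (fastforce simp: V_def FE_space_def Pk_def A_def)
    then obtain c where c: "\<And>T x. T \<in> \<T> \<Longrightarrow> x \<in> T \<Longrightarrow> v x = (\<Sum>\<alpha>\<in>A. c T \<alpha> * (\<Prod>i\<in>UNIV. (x $ i) ^ \<alpha> i))"
      by metis
    have "v x = (\<Sum>i\<in>\<T> \<times> A. (case i of (T, \<alpha>) \<Rightarrow> c T \<alpha>) * g i x)" for x
    proof (cases "x \<in> closure \<Omega>")
      case True
      have "(\<Sum>i\<in>\<T> \<times> A. (case i of (T, \<alpha>) \<Rightarrow> c T \<alpha>) * g i x)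
          = (\<Sum>T\<in>\<T>. \<Sum>\<alpha>\<in>A. c T \<alpha> * g (T, \<alpha>) x)"
        by (simp add: sum.cartesian_product case_prod_unfold)
      also have "\<dots> = (\<Sum>T\<in>\<T>. if cell x = T then \<Sum>\<alpha>\<in>A. c T \<alpha> * (\<Prod>i\<in>UNIV. (x $ i) ^ \<alpha> i) else 0)"
        by (intro sum.cong) (auto simp: g_def True)
      also have "\<dots> = v x"
        using c[of "cell x" x] cell[OF True] fin by simp
      finally show ?thesis by simp
    next
      case False
      then have "g i x = 0" for i by (cases i) (simp add: g_def)
      then show ?thesis using FE_space_outside[OF v[unfolded V_def] False] by simp
    qed
    then show ?thesis by blast
  qed
  then show ?thesis
    using fin finA FE_space_linear_space[OF T]
    by (intro subspace_finitely_generated[where I = "\<T> \<times> A" and g = g]) (auto simp: V_def)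
qed

lemma FE_space_finite_dim_inner_product_space:
  assumes "triangulates \<T> \<Omega>"
  shows "finite_dim_inner_product_space (FE_space \<Omega> \<T> k) (inner_L2 \<Omega>)"
proof
  show "linear_space (FE_space \<Omega> \<T> k)" by (rule FE_space_linear_space[OF assms])
  show "\<exists>E. finite E \<and> E \<subseteq> FE_space \<Omega> \<T> k \<and> (\<forall>v\<in>FE_space \<Omega> \<T> k. \<exists>c. v = (\<lambda>x. \<Sum>e\<in>E. c e * e x))"
    by (rule FE_space_finitely_generated[OF assms])
  show "psd_form_on (FE_space \<Omega> \<T> k) (inner_L2 \<Omega>)"
    by (rule inner_L2_psd_form) (rule H1_imp_L2[OF FE_space_H1])
  show "v = (\<lambda>x. 0)" if "v \<in> FE_space \<Omega> \<T> k" "inner_L2 \<Omega> v v = 0" for v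
    using inner_L2_definite[OF FE_space_continuous[OF that(1)] that(2)] FE_space_outside[OF that(1)] by blast
qed

text \<open>
  The definite description in \<open>L2_proj\<close> is meaningful because the Riesz representation in the finite
  element space exists and is unique. The conservation laws need this at the initial step, where the
  old iterate must be an element of the space.
\<close>
lemma L2_proj_FE_space:
  assumes T: "triangulates \<T> \<Omega>" and f: "f \<in> L2_space \<Omega>"
  shows "L2_proj \<Omega> (FE_space \<Omega> \<T> k) f \<in> FE_space \<Omega> \<T> k"
proof -
  let ?V = "FE_space \<Omega> \<T> k"
  interpret finite_dim_inner_product_space ?V "inner_L2 \<Omega>"
    by (rule FE_space_finite_dim_inner_product_space[OF T])
  have L2: "v \<in> L2_space \<Omega>" if "v \<in> ?V" for v using that by (intro H1_imp_L2 FE_space_H1)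
  have eq: "inner_L2 \<Omega> (\<lambda>x. f x - v x) \<phi> = 0 \<longleftrightarrow> inner_L2 \<Omega> v \<phi> = inner_L2 \<Omega> f \<phi>" if "v \<in> ?V" "\<phi> \<in> ?V" for v \<phi>
    using inner_L2_lincomb_left[OF f L2 L2, of v \<phi> 1 "-1"] that by auto
  have "linear_functional_on ?V (inner_L2 \<Omega> f)"
    using L2 f by (auto simp: linear_functional_on_def inner_L2_lincomb_right)
  then obtain v where v: "v \<in> ?V" "\<forall>\<phi>\<in>?V. inner_L2 \<Omega> v \<phi> = inner_L2 \<Omega> f \<phi>"
    using riesz by blast
  have "\<exists>!v. v \<in> ?V \<and> (\<forall>\<phi>\<in>?V. inner_L2 \<Omega> (\<lambda>x. f x - v x) \<phi> = 0)"
  proof (rule ex1I[of _ v])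
    show "v \<in> ?V \<and> (\<forall>\<phi>\<in>?V. inner_L2 \<Omega> (\<lambda>x. f x - v x) \<phi> = 0)" using v eq by blast
    show "v' = v" if "v' \<in> ?V \<and> (\<forall>\<phi>\<in>?V. inner_L2 \<Omega> (\<lambda>x. f x - v' x) \<phi> = 0)" for v'
      using that v eq by (intro riesz_unique) auto
  qed
  from theI'[OF this] show ?thesis
    unfolding L2_proj_def by (rule conjunct1)
qed

end

section \<open>The time step\<close>

lemma psd_form_add:
  assumes "psd_form_on V a" "psd_form_on V b"
  shows "psd_form_on V (\<lambda>u v. a u v + b u v)"
  using assms by (simp add: psd_form_on_def bilinear_form_on_def linear_functional_on_def algebra_simps)

context bounded_open_set
begin

lemma weighted_inner_L2_psd_form:
  assumes c: "continuous_on (closure \<Omega>) c" "\<And>x. x \<in> \<Omega> \<Longrightarrow> c x \<ge> 0"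
    and V: "\<And>v. v \<in> V \<Longrightarrow> v \<in> L2_space \<Omega>"
  shows "psd_form_on V (\<lambda>u. inner_L2 \<Omega> (\<lambda>x. c x * u x))"
proof -
  have cV: "(\<lambda>x. c x * v x) \<in> L2_space \<Omega>" if "v \<in> V" for v
    using L2_continuous_mult[OF c(1) V[OF that]] by simp
  have left: "inner_L2 \<Omega> (\<lambda>x. c x * (a * u x + b * v x)) \<phi>
      = a * inner_L2 \<Omega> (\<lambda>x. c x * u x) \<phi> + b * inner_L2 \<Omega> (\<lambda>x. c x * v x) \<phi>"
    if "u \<in> V" "v \<in> V" "\<phi> \<in> V" for u v \<phi> a b
    using inner_L2_lincomb_left[OF cV cV V, OF that, of a b] by (simp add: algebra_simps)
  have nonneg: "inner_L2 \<Omega> (\<lambda>x. c x * v x) v \<ge> 0" for v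
    unfolding inner_L2_def
    by (rule integral_nonneg_AE) (use c(2) in \<open>auto intro!: AE_I2 simp: mult.assoc\<close>)
  have sym: "inner_L2 \<Omega> (\<lambda>x. c x * u x) v = inner_L2 \<Omega> (\<lambda>x. c x * v x) u" for u v
    by (rule inner_L2_cong) simp
  show ?thesis
    unfolding psd_form_on_def bilinear_form_on_def linear_functional_on_def
    by (intro conjI ballI allI inner_L2_lincomb_right left nonneg sym cV V)
qed

lemma inner_L2_difference_quotient:
  assumes "u \<in> L2_space \<Omega>" "u' \<in> L2_space \<Omega>" "\<phi> \<in> L2_space \<Omega>"
  shows "inner_L2 \<Omega> (\<lambda>x. (u' x - u x) / \<tau>) \<phi> = (inner_L2 \<Omega> u' \<phi> - inner_L2 \<Omega> u \<phi>) / \<tau>"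
  using inner_L2_lincomb_left[OF assms(2,1,3), of "1 / \<tau>" "- 1 / \<tau>"] by (simp add: diff_divide_distrib)

text \<open>
  Elimination of \<open>U'\<close>. The weight \<open>H(u)\<^sup>2 / 2\<close> arises because \<open>H(u)\<close> enters once in the second equation
  and once more through the pointwise one.
\<close>
lemma scheme_step_iff_mixed_system:
  assumes \<tau>: "\<tau> > 0" and H: "continuous_on (closure \<Omega>) (\<lambda>x. H (u x))"
    and V_FE: "V = FE_space \<Omega> \<T> k" and u: "u \<in> V" and U: "U \<in> C0 \<Omega>"
  shows "scheme_step \<Omega> V \<epsilon> \<tau> H M u U u' w' U' \<longleftrightarrow>
    u' \<in> V \<and> w' \<in> V \<and>
    U' = (\<lambda>x. if x \<in> closure \<Omega> then U x + 1/2 * H (u x) * (u' x - u x) else 0) \<and>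
    (\<forall>\<phi>\<in>V. inner_L2 \<Omega> u' \<phi> + \<tau> * A_form \<Omega> (\<lambda>x. M (u x)) w' \<phi> = inner_L2 \<Omega> u \<phi>) \<and>
    (\<forall>\<psi>\<in>V. inner_L2 \<Omega> w' \<psi>
       = (A_form \<Omega> (\<lambda>_. \<epsilon>\<^sup>2) u' \<psi> + inner_L2 \<Omega> (\<lambda>x. (1/2 * (H (u x))\<^sup>2) * u' x) \<psi>)
         + inner_L2 \<Omega> (\<lambda>x. H (u x) * (U x - 1/2 * H (u x) * u x)) \<psi>)"
  (is "_ \<longleftrightarrow> _ \<and> _ \<and> U' = ?U \<and> _ \<and> _")
proof -
  have L2: "v \<in> L2_space \<Omega>" if "v \<in> V" for v
    using that unfolding V_FE by (intro H1_imp_L2 FE_space_H1)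
  have cont: "continuous_on (closure \<Omega>) v" if "v \<in> V" for v
    using that FE_space_continuous unfolding V_FE by blast
  have contU: "continuous_on (closure \<Omega>) U" using U by (simp add: C0_def)
  have eq1: "(inner_L2 \<Omega> (\<lambda>x. (u' x - u x) / \<tau>) \<phi> = - A_form \<Omega> (\<lambda>x. M (u x)) w' \<phi>)
      \<longleftrightarrow> (inner_L2 \<Omega> u' \<phi> + \<tau> * A_form \<Omega> (\<lambda>x. M (u x)) w' \<phi> = inner_L2 \<Omega> u \<phi>)"
    if "u' \<in> V" "\<phi> \<in> V" for \<phi>
    unfolding inner_L2_difference_quotient[OF L2[OF u] L2[OF that(1)] L2[OF that(2)]]
    using \<tau> by (auto simp: field_simps)
  have eq3: "(U' x - U x) / \<tau> = 1/2 * H (u x) * ((u' x - u x) / \<tau>)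
      \<longleftrightarrow> U' x = U x + 1/2 * H (u x) * (u' x - u x)" for x
    unfolding times_divide_eq_right divide_cancel_right using \<tau> by auto
  have U'_eq: "U' \<in> C0 \<Omega> \<and> (\<forall>x\<in>closure \<Omega>. U' x = U x + 1/2 * H (u x) * (u' x - u x)) \<longleftrightarrow> U' = ?U"
    if "u' \<in> V"
  proof
    assume "U' = ?U"
    moreover have "continuous_on (closure \<Omega>) (\<lambda>x. U x + 1/2 * H (u x) * (u' x - u x))"
      by (intro continuous_intros contU H cont[OF that] cont[OF u])
    then have "continuous_on (closure \<Omega>) ?U" by (rule continuous_on_eq) simp
    ultimately show "U' \<in> C0 \<Omega> \<and> (\<forall>x\<in>closure \<Omega>. U' x = U x + 1/2 * H (u x) * (u' x - u x))"
      by (simp add: C0_def)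
  qed (auto simp: C0_def fun_eq_iff)
  have eq2: "inner_L2 \<Omega> (\<lambda>x. H (u x) * ?U x) \<psi>
      = inner_L2 \<Omega> (\<lambda>x. (1/2 * (H (u x))\<^sup>2) * u' x) \<psi>
        + inner_L2 \<Omega> (\<lambda>x. H (u x) * (U x - 1/2 * H (u x) * u x)) \<psi>" if "u' \<in> V" "\<psi> \<in> V" for \<psi>
  proof -
    let ?f = "\<lambda>x. (1/2 * (H (u x))\<^sup>2) * u' x" and ?g = "\<lambda>x. H (u x) * (U x - 1/2 * H (u x) * u x)"
    have "?f \<in> L2_space \<Omega>" "?g \<in> L2_space \<Omega>"
      by (intro L2_continuous continuous_intros contU H cont[OF that(1)] cont[OF u])+
    then have "inner_L2 \<Omega> (\<lambda>x. 1 * ?f x + 1 * ?g x) \<psi> = 1 * inner_L2 \<Omega> ?f \<psi> + 1 * inner_L2 \<Omega> ?g \<psi>"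
      using L2 that by (intro inner_L2_lincomb_left)
    moreover have "inner_L2 \<Omega> (\<lambda>x. H (u x) * ?U x) \<psi> = inner_L2 \<Omega> (\<lambda>x. 1 * ?f x + 1 * ?g x) \<psi>"
      using closure_subset[of \<Omega>]
      by (intro inner_L2_cong) (auto simp: field_simps power2_eq_square)
    ultimately show ?thesis by simp
  qed
  have "scheme_step \<Omega> V \<epsilon> \<tau> H M u U u' w' U' \<longleftrightarrow>
    u' \<in> V \<and> w' \<in> V \<and> U' = ?U \<and>
    (\<forall>\<phi>\<in>V. inner_L2 \<Omega> u' \<phi> + \<tau> * A_form \<Omega> (\<lambda>x. M (u x)) w' \<phi> = inner_L2 \<Omega> u \<phi>) \<and>
    (\<forall>\<psi>\<in>V. inner_L2 \<Omega> w' \<psi>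
       = A_form \<Omega> (\<lambda>_. \<epsilon>\<^sup>2) u' \<psi> + inner_L2 \<Omega> (\<lambda>x. H (u x) * U' x) \<psi>)"
    unfolding scheme_step_def eq3 using eq1 U'_eq by blast
  also have "\<dots> \<longleftrightarrow> u' \<in> V \<and> w' \<in> V \<and> U' = ?U \<and>
    (\<forall>\<phi>\<in>V. inner_L2 \<Omega> u' \<phi> + \<tau> * A_form \<Omega> (\<lambda>x. M (u x)) w' \<phi> = inner_L2 \<Omega> u \<phi>) \<and>
    (\<forall>\<psi>\<in>V. inner_L2 \<Omega> w' \<psi>
       = (A_form \<Omega> (\<lambda>_. \<epsilon>\<^sup>2) u' \<psi> + inner_L2 \<Omega> (\<lambda>x. (1/2 * (H (u x))\<^sup>2) * u' x) \<psi>)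
         + inner_L2 \<Omega> (\<lambda>x. H (u x) * (U x - 1/2 * H (u x) * u x)) \<psi>)"
    using eq2 by (auto simp only: add.assoc)
  finally show ?thesis .
qed

lemma scheme_step_unique_solution:
  assumes \<tau>: "\<tau> > 0" and T: "triangulates \<T> \<Omega>"
    and H: "continuous_on (closure \<Omega>) (\<lambda>x. H (u x))"
    and M: "continuous_on (closure \<Omega>) (\<lambda>x. M (u x))" "\<And>x. x \<in> \<Omega> \<Longrightarrow> M (u x) \<ge> 0"
    and V_FE: "V = FE_space \<Omega> \<T> k" and u: "u \<in> V" and U: "U \<in> C0 \<Omega>"
  shows "\<exists>!(u', w', U'). scheme_step \<Omega> V \<epsilon> \<tau> H M u U u' w' U'"
proof -
  interpret finite_dim_inner_product_space V "inner_L2 \<Omega>"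
    unfolding V_FE by (rule FE_space_finite_dim_inner_product_space[OF T])
  have H1: "v \<in> H1_space \<Omega>" if "v \<in> V" for v
    using that FE_space_H1 unfolding V_FE by blast
  have L2: "v \<in> L2_space \<Omega>" if "v \<in> V" for v
    using that by (intro H1_imp_L2 H1)
  have cont: "continuous_on (closure \<Omega>) v" if "v \<in> V" for v
    using that FE_space_continuous unfolding V_FE by blast
  let ?k = "A_form \<Omega> (\<lambda>x. M (u x))"
  let ?a = "\<lambda>v \<psi>. A_form \<Omega> (\<lambda>_. \<epsilon>\<^sup>2) v \<psi> + inner_L2 \<Omega> (\<lambda>x. (1/2 * (H (u x))\<^sup>2) * v x) \<psi>"
  let ?f = "\<lambda>x. H (u x) * (U x - 1/2 * H (u x) * u x)"
  have k: "psd_form_on V ?k" using M H1 by (intro A_form_psd_form)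
  have a: "psd_form_on V ?a"
    by (intro psd_form_add A_form_psd_form weighted_inner_L2_psd_form continuous_intros H H1 L2) auto
  have contU: "continuous_on (closure \<Omega>) U" using U by (simp add: C0_def)
  have f: "?f \<in> L2_space \<Omega>"
    by (intro L2_continuous continuous_intros H contU cont[OF u])
  have lin: "linear_functional_on V (inner_L2 \<Omega> f)" if "f \<in> L2_space \<Omega>" for f
    using that L2 by (auto simp: linear_functional_on_def inner_L2_lincomb_right)
  obtain u' w' where uw: "u' \<in> V" "w' \<in> V"
    "\<forall>\<phi>\<in>V. inner_L2 \<Omega> u' \<phi> + \<tau> * ?k w' \<phi> = inner_L2 \<Omega> u \<phi>"
    "\<forall>\<psi>\<in>V. inner_L2 \<Omega> w' \<psi> = ?a u' \<psi> + inner_L2 \<Omega> ?f \<psi>"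
    using mixed_system_solvable[OF k a \<tau> lin[OF L2[OF u]] lin[OF f]] by blast
  note step = scheme_step_iff_mixed_system[OF \<tau> H V_FE u U, of \<epsilon> M]
  show ?thesis
  proof (rule ex1I[of _ "(u', w', \<lambda>x. if x \<in> closure \<Omega> then U x + 1/2 * H (u x) * (u' x - u x) else 0)"])
    show "case (u', w', \<lambda>x. if x \<in> closure \<Omega> then U x + 1/2 * H (u x) * (u' x - u x) else 0) of
        (u', w', U') \<Rightarrow> scheme_step \<Omega> V \<epsilon> \<tau> H M u U u' w' U'"
      unfolding prod.case step using uw by blast
    fix z assume "case z of (u', w', U') \<Rightarrow> scheme_step \<Omega> V \<epsilon> \<tau> H M u U u' w' U'"
    then obtain u'' w'' U'' where z: "z = (u'', w'', U'')"
      and "scheme_step \<Omega> V \<epsilon> \<tau> H M u U u'' w'' U''" by (cases z) auto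
    note sol = this(2)[unfolded step]
    have "u'' = u' \<and> w'' = w'"
      by (rule mixed_system_unique[OF k a \<tau>, where l = "inner_L2 \<Omega> u" and g = "inner_L2 \<Omega> ?f"])
         (use sol uw in blast)+
    then have eqs: "u'' = u'" "w'' = w'" by simp_all
    have "U'' = (\<lambda>x. if x \<in> closure \<Omega> then U x + 1/2 * H (u x) * (u'' x - u x) else 0)"
      using sol by blast
    then show "z = (u', w', \<lambda>x. if x \<in> closure \<Omega> then U x + 1/2 * H (u x) * (u' x - u x) else 0)"
      unfolding z eqs by (simp only:)
  qed
qed

lemma scheme_step_mass_conservation:
  assumes \<tau>: "\<tau> > 0" and T: "triangulates \<T> \<Omega>"
    and V_FE: "V = FE_space \<Omega> \<T> k" and u: "u \<in> V"
    and step: "scheme_step \<Omega> V \<epsilon> \<tau> H M u U u' w' U'"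
  shows "integral\<^sup>L (lebesgue_on \<Omega>) u' = integral\<^sup>L (lebesgue_on \<Omega>) u"
proof -
  define one where "one x = (if x \<in> closure \<Omega> then 1 else 0 :: real)" for x
  have one: "one \<in> V"
    using FE_space_indicator[OF T, of 1 k] unfolding V_FE one_def .
  have one_eq: "one x = 1" if "x \<in> \<Omega>" for x
    using that closure_subset by (auto simp: one_def)
  have L2: "v \<in> L2_space \<Omega>" if "v \<in> V" for v
    using that unfolding V_FE by (intro H1_imp_L2 FE_space_H1)
  have u': "u' \<in> V" using step by (simp add: scheme_step_def)
  have mean: "inner_L2 \<Omega> v one = integral\<^sup>L (lebesgue_on \<Omega>) v" for v
    unfolding inner_L2_def by (rule Bochner_Integration.integral_cong) (auto simp: one_eq)
  have "inner_L2 \<Omega> (\<lambda>x. (u' x - u x) / \<tau>) one = - A_form \<Omega> (\<lambda>x. M (u x)) w' one"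
    using step one by (simp add: scheme_step_def)
  also have "\<dots> = 0" using A_form_constant[OF one_eq] by simp
  finally show ?thesis
    using \<tau> by (simp add: inner_L2_difference_quotient[OF L2[OF u] L2[OF u'] L2[OF one]] mean)
qed

text \<open>
  Test the first equation with \<open>w'\<close> and the second with the increment \<open>d = u' - u\<close>. Equating the two
  expressions for \<open>ip w' d\<close> gives the dissipation; the two remaining terms are increments of the
  quadratic energies, up to the squares of the increments of \<open>u\<close> and \<open>U\<close>.
\<close>
lemma scheme_step_energy:
  assumes \<tau>: "\<tau> > 0" and T: "triangulates \<T> \<Omega>"
    and V_FE: "V = FE_space \<Omega> \<T> k" and u: "u \<in> V" and U: "U \<in> C0 \<Omega>"
    and step: "scheme_step \<Omega> V \<epsilon> \<tau> H M u U u' w' U'"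
  shows "energy \<Omega> \<epsilon> B u' U' = energy \<Omega> \<epsilon> B u U - (norm_L2 \<Omega> (\<lambda>x. U' x - U x))\<^sup>2
    - \<tau> * A_form \<Omega> (\<lambda>x. M (u x)) w' w'
    - 1/2 * A_form \<Omega> (\<lambda>_. \<epsilon>\<^sup>2) (\<lambda>x. u' x - u x) (\<lambda>x. u' x - u x)"
proof -
  let ?S = "A_form \<Omega> (\<lambda>_. \<epsilon>\<^sup>2)"
  let ?d = "\<lambda>x. u' x - u x"
  have u': "u' \<in> V" and w': "w' \<in> V" and U': "U' \<in> C0 \<Omega>"
    and eq1: "\<And>\<phi>. \<phi> \<in> V \<Longrightarrow> inner_L2 \<Omega> (\<lambda>x. (u' x - u x) / \<tau>) \<phi> = - A_form \<Omega> (\<lambda>x. M (u x)) w' \<phi>"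
    and eq2: "\<And>\<psi>. \<psi> \<in> V \<Longrightarrow> inner_L2 \<Omega> w' \<psi> = ?S u' \<psi> + inner_L2 \<Omega> (\<lambda>x. H (u x) * U' x) \<psi>"
    and eq3: "\<And>x. x \<in> closure \<Omega> \<Longrightarrow> (U' x - U x) / \<tau> = 1/2 * H (u x) * ((u' x - u x) / \<tau>)"
    using step by (auto simp: scheme_step_def)
  have H1: "v \<in> H1_space \<Omega>" if "v \<in> V" for v
    using that FE_space_H1 unfolding V_FE by blast
  have L2: "v \<in> L2_space \<Omega>" if "v \<in> V" for v
    using that by (intro H1_imp_L2 H1)
  have d: "?d \<in> V"
    using FE_space_linear_space[OF T] u u' unfolding V_FE by (intro linear_space_diff)
  have UL2: "U \<in> L2_space \<Omega>" "U' \<in> L2_space \<Omega>"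
    using U U' by (auto simp: C0_def intro: L2_continuous)

  have "inner_L2 \<Omega> ?d w' = - \<tau> * A_form \<Omega> (\<lambda>x. M (u x)) w' w'"
  proof -
    have "inner_L2 \<Omega> ?d w' = inner_L2 \<Omega> u' w' - inner_L2 \<Omega> u w'"
      using inner_L2_difference_quotient[OF L2[OF u] L2[OF u'] L2[OF w'], of 1] by simp
    also have "\<dots> = \<tau> * inner_L2 \<Omega> (\<lambda>x. (u' x - u x) / \<tau>) w'"
      using \<tau> inner_L2_difference_quotient[OF L2[OF u] L2[OF u'] L2[OF w'], of \<tau>] by simp
    finally show ?thesis using eq1[OF w'] by simp
  qed
  then have dissipation: "?S u' ?d + inner_L2 \<Omega> (\<lambda>x. H (u x) * U' x) ?d
      = - \<tau> * A_form \<Omega> (\<lambda>x. M (u x)) w' w'"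
    using eq2[OF d] by (simp add: inner_L2_commute)

  have potential: "inner_L2 \<Omega> (\<lambda>x. H (u x) * U' x) ?d = 2 * inner_L2 \<Omega> U' U' - 2 * inner_L2 \<Omega> U' U"
  proof -
    have "inner_L2 \<Omega> (\<lambda>x. H (u x) * U' x) ?d = inner_L2 \<Omega> U' (\<lambda>x. 2 * U' x + (- 2) * U x)"
    proof (rule inner_L2_cong)
      fix x assume "x \<in> \<Omega>"
      then have "(U' x - U x) / \<tau> = 1/2 * H (u x) * ((u' x - u x) / \<tau>)"
        using eq3 closure_subset by blast
      note rate = this
      have "2 * (U' x - U x) = 2 * (\<tau> * ((U' x - U x) / \<tau>))" using \<tau> by simp
      also have "\<dots> = H (u x) * (u' x - u x)" unfolding rate using \<tau> by simp
      finally have "2 * (U' x - U x) = H (u x) * (u' x - u x)" .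
      then show "H (u x) * U' x * (u' x - u x) = U' x * (2 * U' x + (- 2) * U x)"
        by (metis add_uminus_conv_diff mult.assoc mult.commute mult_minus_left right_diff_distrib)
    qed
    also have "\<dots> = 2 * inner_L2 \<Omega> U' U' + (- 2) * inner_L2 \<Omega> U' U"
      using UL2 by (intro inner_L2_lincomb_right)
    finally show ?thesis by simp
  qed

  have increment: "(norm_L2 \<Omega> (\<lambda>x. U' x - U x))\<^sup>2
      = inner_L2 \<Omega> U' U' - 2 * inner_L2 \<Omega> U' U + inner_L2 \<Omega> U U"
  proof -
    have UU: "(\<lambda>x. U' x - U x) \<in> L2_space \<Omega>"
      using L2_lincomb[OF UL2(2,1), of 1 "-1"] by simp
    have "(norm_L2 \<Omega> (\<lambda>x. U' x - U x))\<^sup>2 = inner_L2 \<Omega> (\<lambda>x. U' x - U x) (\<lambda>x. U' x - U x)"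
      using inner_L2_self_nonneg by (simp add: norm_L2_def)
    also have "\<dots> = inner_L2 \<Omega> U' (\<lambda>x. U' x - U x) - inner_L2 \<Omega> U (\<lambda>x. U' x - U x)"
      using inner_L2_lincomb_left[OF UL2(2,1) UU, of 1 "-1"] by simp
    also have "\<dots> = inner_L2 \<Omega> U' U' - inner_L2 \<Omega> U' U - (inner_L2 \<Omega> U U' - inner_L2 \<Omega> U U)"
      using inner_L2_lincomb_right[OF UL2(2,1,2), of 1 "-1"] inner_L2_lincomb_right[OF UL2(2,1,1), of 1 "-1"]
      by simp
    finally show ?thesis using inner_L2_commute[of \<Omega> U U'] by simp
  qed

  have S_right: "?S v ?d = ?S v u' - ?S v u" if "v \<in> V" for v
    using A_form_lincomb_left[OF continuous_on_const H1[OF u'] H1[OF u] H1[OF that], of "\<epsilon>\<^sup>2" 1 "-1"]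
    by (simp add: A_form_commute[of _ v])
  have "?S ?d ?d = ?S u' u' - 2 * ?S u' u + ?S u u"
    using S_right[OF d] S_right[OF u] S_right[OF u'] A_form_commute[of "\<lambda>_. \<epsilon>\<^sup>2"] by simp
  then have "1/2 * ?S u' u' - 1/2 * ?S u u = ?S u' ?d - 1/2 * ?S ?d ?d"
    using S_right[OF u'] by (simp add: field_simps)
  moreover have "energy \<Omega> \<epsilon> B v W = 1/2 * ?S v v + inner_L2 \<Omega> W W - B * measure lebesgue \<Omega>" for v W
    by (simp add: energy_def inner_L2_def power2_eq_square)
  ultimately show ?thesis
    using dissipation potential increment by simp
qed

end

lemma continuous_on_H_fun:
  assumes F: "\<And>s. s \<in> I \<Longrightarrow> (F has_real_derivative F' s) (at s within I)" "continuous_on I F'"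
    and u: "continuous_on S u" "\<And>x. x \<in> S \<Longrightarrow> u x \<in> I \<and> F (u x) + B > 0"
  shows "continuous_on S (\<lambda>x. H_fun F F' B (u x))"
proof -
  have "continuous_on I F"
    using F(1) by (rule DERIV_continuous_on)
  then have "continuous_on S (\<lambda>x. F (u x))" "continuous_on S (\<lambda>x. F' (u x))"
    using F(2) u by (auto intro: continuous_on_compose2)
  then show ?thesis
    unfolding H_fun_def using u(2) by (intro continuous_intros) force+
qed

theorem theorem2p1:
  fixes \<Omega> :: "(real^'d) set" and \<T> :: "(real^'d) set set" and k :: nat
    and \<epsilon> \<Delta>t B \<rho> :: real and I J :: "real set"
    and F F' M :: "real \<Rightarrow> real" and u0 :: "real^'d \<Rightarrow> real"
  defines "Vh \<equiv> FE_space \<Omega> \<T> k" and "H \<equiv> H_fun F F' B"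
  assumes dim: "CARD('d) = 2 \<or> CARD('d) = 3"
    and domain: "open \<Omega>" "connected \<Omega>" "bounded \<Omega>" "\<Omega> \<noteq> {}"
    and mesh: "triangulates \<T> \<Omega>" "quasi_uniform \<rho> \<T>"
    and k: "k \<ge> 1"
    and eps: "\<epsilon> > 0" and dt: "\<Delta>t > 0"
    and F: "is_interval I" "\<And>s. s \<in> I \<Longrightarrow> (F has_real_derivative F' s) (at s within I)"
      "continuous_on I F'"
    and B: "B \<ge> 0"
    and M: "continuous_on J M" "\<And>s. s \<in> J \<Longrightarrow> M s \<ge> 0"
    and u0: "u0 \<in> L2_space \<Omega>" "\<And>x. x \<in> closure \<Omega> \<Longrightarrow> u0 x \<in> I \<and> F (u0 x) + B > 0"
      "continuous_on (closure \<Omega>) (\<lambda>x. sqrt (F (u0 x) + B))"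
  shows "(\<forall>u\<in>Vh. \<forall>U\<in>C0 \<Omega>.
            (\<forall>x\<in>closure \<Omega>. u x \<in> I \<and> u x \<in> J \<and> F (u x) + B > 0) \<longrightarrow>
            (\<exists>!(u', w', U'). scheme_step \<Omega> Vh \<epsilon> \<Delta>t H M u U u' w' U'))
       \<and> (\<forall>N u w U.
            u 0 = L2_proj \<Omega> Vh u0 \<and>
            U 0 \<in> C0 \<Omega> \<and> (\<forall>x\<in>closure \<Omega>. U 0 x = sqrt (F (u0 x) + B)) \<and>
            (\<forall>n<N. (\<forall>x\<in>closure \<Omega>. u n x \<in> I \<and> u n x \<in> J \<and> F (u n x) + B > 0) \<and>
                   scheme_step \<Omega> Vh \<epsilon> \<Delta>t H M (u n) (U n) (u (Suc n)) (w (Suc n)) (U (Suc n)))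
            \<longrightarrow>
            (\<forall>n. 0 < n \<and> n \<le> N \<longrightarrow>
               integral\<^sup>L (lebesgue_on \<Omega>) (u n) = integral\<^sup>L (lebesgue_on \<Omega>) (u 0)) \<and>
            (\<forall>n<N.
               energy \<Omega> \<epsilon> B (u (Suc n)) (U (Suc n))
                 = energy \<Omega> \<epsilon> B (u n) (U n)
                   - (norm_L2 \<Omega> (\<lambda>x. U (Suc n) x - U n x))\<^sup>2
                   - \<Delta>t * A_form \<Omega> (\<lambda>x. M (u n x)) (w (Suc n)) (w (Suc n))
                   - 1/2 * A_form \<Omega> (\<lambda>_. \<epsilon>\<^sup>2) (\<lambda>x. u (Suc n) x - u n x) (\<lambda>x. u (Suc n) x - u n x)))"
proof -
  interpret bounded_open_set \<Omega> using domain by unfold_locales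
  have Vh: "Vh = FE_space \<Omega> \<T> k" by (simp add: Vh_def)
  show ?thesis
  proof (rule conjI)
    show "\<forall>u\<in>Vh. \<forall>U\<in>C0 \<Omega>.
        (\<forall>x\<in>closure \<Omega>. u x \<in> I \<and> u x \<in> J \<and> F (u x) + B > 0) \<longrightarrow>
        (\<exists>!(u', w', U'). scheme_step \<Omega> Vh \<epsilon> \<Delta>t H M u U u' w' U')"
    proof (intro ballI impI)
      fix u U assume u: "u \<in> Vh" and U: "U \<in> C0 \<Omega>"
        and range: "\<forall>x\<in>closure \<Omega>. u x \<in> I \<and> u x \<in> J \<and> F (u x) + B > 0"
      have cont: "continuous_on (closure \<Omega>) u"
        using u FE_space_continuous unfolding Vh by blast
      show "\<exists>!(u', w', U'). scheme_step \<Omega> Vh \<epsilon> \<Delta>t H M u U u' w' U'"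
      proof (rule scheme_step_unique_solution[OF dt mesh(1) _ _ _ Vh u U])
        show "continuous_on (closure \<Omega>) (\<lambda>x. H (u x))"
          unfolding H_def by (rule continuous_on_H_fun[OF F(2,3) cont]) (use range in auto)
        show "continuous_on (closure \<Omega>) (\<lambda>x. M (u x))"
          by (rule continuous_on_compose2[OF M(1) cont]) (use range in auto)
        show "M (u x) \<ge> 0" if "x \<in> \<Omega>" for x
          using that range M(2) closure_subset by blast
      qed
    qed
  next
    show "\<forall>N u w U.
            u 0 = L2_proj \<Omega> Vh u0 \<and>
            U 0 \<in> C0 \<Omega> \<and> (\<forall>x\<in>closure \<Omega>. U 0 x = sqrt (F (u0 x) + B)) \<and>
            (\<forall>n<N. (\<forall>x\<in>closure \<Omega>. u n x \<in> I \<and> u n x \<in> J \<and> F (u n x) + B > 0) \<and>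
                   scheme_step \<Omega> Vh \<epsilon> \<Delta>t H M (u n) (U n) (u (Suc n)) (w (Suc n)) (U (Suc n)))
            \<longrightarrow>
            (\<forall>n. 0 < n \<and> n \<le> N \<longrightarrow>
               integral\<^sup>L (lebesgue_on \<Omega>) (u n) = integral\<^sup>L (lebesgue_on \<Omega>) (u 0)) \<and>
            (\<forall>n<N.
               energy \<Omega> \<epsilon> B (u (Suc n)) (U (Suc n))
                 = energy \<Omega> \<epsilon> B (u n) (U n)
                   - (norm_L2 \<Omega> (\<lambda>x. U (Suc n) x - U n x))\<^sup>2
                   - \<Delta>t * A_form \<Omega> (\<lambda>x. M (u n x)) (w (Suc n)) (w (Suc n))
                   - 1/2 * A_form \<Omega> (\<lambda>_. \<epsilon>\<^sup>2) (\<lambda>x. u (Suc n) x - u n x) (\<lambda>x. u (Suc n) x - u n x))"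
    proof (intro allI impI, elim conjE)
      fix N :: nat and u w U
      assume init: "u 0 = L2_proj \<Omega> Vh u0" "U 0 \<in> C0 \<Omega>"
        and "\<forall>n<N. (\<forall>x\<in>closure \<Omega>. u n x \<in> I \<and> u n x \<in> J \<and> F (u n x) + B > 0) \<and>
              scheme_step \<Omega> Vh \<epsilon> \<Delta>t H M (u n) (U n) (u (Suc n)) (w (Suc n)) (U (Suc n))"
      then have step: "scheme_step \<Omega> Vh \<epsilon> \<Delta>t H M (u n) (U n) (u (Suc n)) (w (Suc n)) (U (Suc n))"
        if "n < N" for n using that by blast
      have iterates: "u n \<in> Vh \<and> U n \<in> C0 \<Omega>" if "n \<le> N" for n
      proof (cases n)
        case 0
        then show ?thesis using init L2_proj_FE_space[OF mesh(1) u0(1)] unfolding Vh by simp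
      next
        case (Suc m)
        then show ?thesis using step[of m] that by (simp add: scheme_step_def)
      qed
      have mass: "integral\<^sup>L (lebesgue_on \<Omega>) (u n) = integral\<^sup>L (lebesgue_on \<Omega>) (u 0)" if "n \<le> N" for n
        using that
      proof (induction n)
        case (Suc n)
        then show ?case
          using scheme_step_mass_conservation[OF dt mesh(1) Vh _ step[of n]] iterates[of n] by simp
      qed simp
      have "energy \<Omega> \<epsilon> B (u (Suc n)) (U (Suc n))
          = energy \<Omega> \<epsilon> B (u n) (U n)
            - (norm_L2 \<Omega> (\<lambda>x. U (Suc n) x - U n x))\<^sup>2
            - \<Delta>t * A_form \<Omega> (\<lambda>x. M (u n x)) (w (Suc n)) (w (Suc n))
            - 1/2 * A_form \<Omega> (\<lambda>_. \<epsilon>\<^sup>2) (\<lambda>x. u (Suc n) x - u n x) (\<lambda>x. u (Suc n) x - u n x)"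
        if "n < N" for n
        using scheme_step_energy[OF dt mesh(1) Vh _ _ step[OF that]] iterates[of n] that by simp
      with mass show "(\<forall>n. 0 < n \<and> n \<le> N \<longrightarrow>
               integral\<^sup>L (lebesgue_on \<Omega>) (u n) = integral\<^sup>L (lebesgue_on \<Omega>) (u 0)) \<and>
            (\<forall>n<N.
               energy \<Omega> \<epsilon> B (u (Suc n)) (U (Suc n))
                 = energy \<Omega> \<epsilon> B (u n) (U n)
                   - (norm_L2 \<Omega> (\<lambda>x. U (Suc n) x - U n x))\<^sup>2
                   - \<Delta>t * A_form \<Omega> (\<lambda>x. M (u n x)) (w (Suc n)) (w (Suc n))
                   - 1/2 * A_form \<Omega> (\<lambda>_. \<epsilon>\<^sup>2) (\<lambda>x. u (Suc n) x - u n x) (\<lambda>x. u (Suc n) x - u n x))"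
        by blast
    qed
  qed
qed

end
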